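(* Let $M\ge 1$ be an integer, let $U\subset\mathbb{R}^{n+1}$ be a bounded slice Cauchy domain, let $\mathrm{j}\in\mathbb{S}$ and set $ds_{\mathrm{j}}=ds\,(-\mathrm{j})$. (I) If $F$ is left poly slice monogenic of order $M$ on an axially symmetric open set containing $\overline U$, with components $f_0,\dots,f_{M-1}$ (left slice monogenic, $F(x)=\sum_{k=0}^{M-1}\overline{x}^k f_k(x)$), then $$F(x)=\frac{1}{2\pi}\int_{\partial(U\cap\mathbb{C}_{\mathrm{j}})}\sum_{k=0}^{M-1}\overline{x}^k S_L^{-1}(s,x)\,ds_{\mathrm{j}}\,f_k(s)\qquad\text{for all }x\in U.$$ (II) If $F$ is right poly slice monogenic of order $M$ on an axially symmetric open set containing $\overline U$, with components $f_0,\dots,f_{M-1}$ (right slice monogenic, $F(x)=\sum_{k=0}^{M-1}f_k(x)\overline{x}^k$), then $$F(x)=\frac{1}{2\pi}\int_{\partial(U\cap\mathbb{C}_{\mathrm{j}})}\sum_{k=0}^{M-1} f_k(s)\,ds_{\mathrm{j}}\,S_R^{-1}(s,x)\overline{x}^k\qquad\text{for all }x\in U.$$ The integrals depend neither on $U$ nor on the imaginary unit $\mathrm{j}\in\mathbb{S}$.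
   Context: $\mathbb{R}_n$ is the real Clifford algebra generated by $e_1,\dots,e_n$ with $e_\ell e_m+e_me_\ell=0$ ($\ell\ne m$), $e_\ell^2=-1$. A point $(x_0,\dots,x_n)\in\mathbb{R}^{n+1}$ is identified with the paravector $x=x_0+\sum_{\ell=1}^n x_\ell e_\ell\in\mathbb{R}_n$; $\mathrm{Re}(x)=x_0$, $\overline{x}=x_0-\sum x_\ell e_\ell$, $|x|^2=\sum_{\ell=0}^n x_\ell^2$. $\mathbb{S}=\{\sum_{\ell=1}^n x_\ell e_\ell:\sum x_\ell^2=1\}$, so $\mathrm{j}^2=-1$ for $\mathrm{j}\in\mathbb{S}$; $\mathbb{C}_{\mathrm{j}}=\mathbb{R}+\mathrm{j}\mathbb{R}$. For $x=x_0+\underline{x}$, $[x]=\{x_0+\mathrm{j}|\underline{x}|:\mathrm{j}\in\mathbb{S}\}$. A set $U\subset\mathbb{R}^{n+1}$ is axially symmetric if $[x]\subset U$ for all $x\in U$. Let $U$ be axially symmetric and open and $\mathcal{U}=\{(u,v)\in\mathbb{R}^2:u+\mathbb{S}v\subset U\}$. A left (right) slice function is $F:U\to\mathbb{R}_n$ with $F(u+\mathrm{j}v)=F_0(u,v)+\mathrm{j}F_1(u,v)$ (resp. $F_0(u,v)+F_1(u,v)\mathrm{j}$) for all $\mathrm{j}\in\mathbb{S}$, where $F_0,F_1:\mathcal{U}\to\mathbb{R}_n$ satisfy $F_0(u,-v)=F_0(u,v)$, $F_1(u,-v)=-F_1(u,v)$. It is left (right) poly slice monogenic of order $M$ if $F_0,F_1$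 are of class $\mathcal{C}^M$ and, for all $\mathrm{j}\in\mathbb{S}$, $\frac{1}{2^M}(\partial_u+\mathrm{j}\partial_v)^M(F_0+\mathrm{j}F_1)=0$ (resp. $(F_0+F_1\mathrm{j})\frac{1}{2^M}(\partial_u+\mathrm{j}\partial_v)^M=0$, with $\mathrm{j}$ multiplying from the right). Order $M=1$ gives left (right) slice monogenic functions. Every left (right) poly slice monogenic $F$ of order $M$ has a unique decomposition $F(x)=\sum_{k=0}^{M-1}\overline{x}^kf_k(x)$ (resp. $\sum_{k=0}^{M-1} f_k(x)\overline{x}^k$) with $f_k$ left (right) slice monogenic; the $f_k$ are called the components of $F$. Cauchy kernels, for $s\notin[x]$: $S_L^{-1}(s,x)=-(x^2-2\mathrm{Re}(s)x+|s|^2)^{-1}(x-\overline{s})$, $S_R^{-1}(s,x)=-(x-\overline{s})(x^2-2\mathrm{Re}(s)x+|s|^2)^{-1}$. A slice Cauchy domain is an axially symmetric open set $U$ such that for every $\mathrm{j}\in\mathbb{S}$ the boundary $\partial(U\cap\mathbb{C}_{\mathrm{j}})$ is a finite union of non-intersecting piecewise continuously differentiable Jordan curves, positively oriented with respect to $U\cap\mathbb{C}_{\mathrm{j}}$. *)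

theory Defs
  imports "HOL-Complex_Analysis.Complex_Analysis"
begin

section \<open>The real Clifford algebra\<close>

text \<open>
  The generators are indexed by a finite linearly ordered type \<open>'n\<close>, so that
  \<open>n = CARD('n) \<ge> 1\<close> is arbitrary. An element is given by its real coordinates in the basis
  \<open>e\<^sub>A = e\<^bsub>a\<^sub>1\<^esub> \<dots> e\<^bsub>a\<^sub>k\<^esub>\<close>, where \<open>A = {a\<^sub>1 < \<dots> < a\<^sub>k}\<close> runs through the subsets of \<open>'n\<close>.
  The order of \<open>'n\<close> only serves to fix this basis.
\<close>

typedef 'n clifford = "UNIV :: ('n set \<Rightarrow> real) set"
  morphisms coeff Clifford ..

lemma coeff_Clifford [simp]: "coeff (Clifford f) = f"
  by (simp add: Clifford_inverse)

lemma clifford_eqI: "(\<And>A. coeff x A = coeff y A) \<Longrightarrow> x = y"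
  using coeff_inject by blast

lemma clifford_eq_iff: "x = y \<longleftrightarrow> (\<forall>A. coeff x A = coeff y A)"
  using clifford_eqI by blast

instantiation clifford :: (type) real_vector
begin

definition "0 = Clifford (\<lambda>A. 0)"
definition "x + y = Clifford (\<lambda>A. coeff x A + coeff y A)"
definition "- x = Clifford (\<lambda>A. - coeff x A)"
definition "x - y = Clifford (\<lambda>A. coeff x A - coeff y A)"
definition "r *\<^sub>R x = Clifford (\<lambda>A. r * coeff x A)"

instance
  by standard
    (simp_all add: clifford_eq_iff zero_clifford_def plus_clifford_def uminus_clifford_def
      minus_clifford_def scaleR_clifford_def algebra_simps)

end

lemma coeff_simps [simp]:
  "coeff 0 A = 0" "coeff (x + y) A = coeff x A + coeff y A" "coeff (- x) A = - coeff x A"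
  "coeff (x - y) A = coeff x A - coeff y A" "coeff (r *\<^sub>R x) A = r * coeff x A"
  by (simp_all add: zero_clifford_def plus_clifford_def uminus_clifford_def
      minus_clifford_def scaleR_clifford_def)

lemma coeff_sum: "coeff (sum f S) A = (\<Sum>i\<in>S. coeff (f i) A)"
  by (induction S rule: infinite_finite_induct) auto

text \<open>
  Sorting \<open>e\<^sub>A e\<^sub>B\<close> exchanges each \<open>a \<in> A\<close> with every smaller \<open>b \<in> B\<close>, and each common
  generator contributes a square \<open>-1\<close>; hence \<open>e\<^sub>A e\<^sub>B = blade_sign A B \<cdot> e\<^bsub>sym_diff A B\<^esub>\<close>.
\<close>

definition blade_sign :: "'n::linorder set \<Rightarrow> 'n set \<Rightarrow> real" where
  "blade_sign A B = (- 1) ^ card {(a, b). a \<in> A \<and> b \<in> B \<and> b \<le> a}"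

lemma blade_sign_prod:
  fixes A B :: "'n::{finite,linorder} set"
  shows "blade_sign A B = (\<Prod>a\<in>A. \<Prod>b\<in>B. if b \<le> a then - 1 else 1)"
proof -
  have "(\<Prod>a\<in>A. \<Prod>b\<in>B. if b \<le> a then - 1 else 1 :: real)
      = (\<Prod>p\<in>A \<times> B. if snd p \<le> fst p then - 1 else 1)"
    by (simp add: prod.cartesian_product case_prod_unfold)
  also have "\<dots> = (\<Prod>p\<in>{p \<in> A \<times> B. snd p \<le> fst p}. - 1)"
    by (rule prod.mono_neutral_cong_right) auto
  also have "{p \<in> A \<times> B. snd p \<le> fst p} = {(a, b). a \<in> A \<and> b \<in> B \<and> b \<le> a}"
    by auto
  finally show ?thesis
    by (simp add: blade_sign_def)
qed

lemma prod_sym_diff_involutive: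
  fixes f :: "'a::finite \<Rightarrow> real"
  assumes "\<And>x. f x * f x = 1"
  shows "prod f (sym_diff A B) = prod f A * prod f B"
proof -
  have "prod f A = prod f (A - B) * prod f (A \<inter> B)"
    by (subst prod.union_disjoint [symmetric]) (auto intro!: arg_cong [where f = "prod f"])
  moreover have "prod f B = prod f (B - A) * prod f (A \<inter> B)"
    by (subst prod.union_disjoint [symmetric]) (auto intro!: arg_cong [where f = "prod f"])
  moreover have "prod f (sym_diff A B) = prod f (A - B) * prod f (B - A)"
    by (subst prod.union_disjoint [symmetric]) auto
  moreover have "prod f (A \<inter> B) * prod f (A \<inter> B) = 1"
    using assms by (simp add: prod.distrib [symmetric])
  ultimately show ?thesis
    by (simp add: mult.assoc mult.left_commute)
qed

lemma blade_sign_sym_diff_left: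
  fixes A B C :: "'n::{finite,linorder} set"
  shows "blade_sign (sym_diff A B) C = blade_sign A C * blade_sign B C"
  unfolding blade_sign_prod
  by (rule prod_sym_diff_involutive) (auto simp: prod.distrib [symmetric] intro: prod.neutral)

lemma blade_sign_sym_diff_right:
  fixes A B C :: "'n::{finite,linorder} set"
  shows "blade_sign A (sym_diff B C) = blade_sign A B * blade_sign A C"
  unfolding blade_sign_prod
  by (subst prod_sym_diff_involutive) (auto simp: prod.distrib)

lemma blade_sign_empty [simp]: "blade_sign {} B = 1" "blade_sign A {} = 1"
  by (simp_all add: blade_sign_def)

instantiation clifford :: ("{finite,linorder}") real_algebra_1
begin

definition "1 = Clifford (\<lambda>A. if A = {} then 1 else 0)"

text \<open>The \<open>C\<close>-coordinate of a product collects all pairs \<open>(A, B)\<close> with \<open>sym_diff A B = C\<close>.\<close>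

definition "x * y =
  Clifford (\<lambda>C. \<Sum>A\<in>UNIV. blade_sign A (sym_diff A C) * coeff x A * coeff y (sym_diff A C))"

instance
proof
  fix x y z :: "'a clifford" and r :: real
  show "x * y * z = x * (y * z)"
  proof (rule clifford_eqI)
    fix D :: "'a set"
    have "coeff (x * y * z) D = (\<Sum>C\<in>UNIV. \<Sum>A\<in>UNIV. blade_sign C (sym_diff C D) *
        (blade_sign A (sym_diff A C) * coeff x A * coeff y (sym_diff A C)) * coeff z (sym_diff C D))"
      by (simp add: times_clifford_def sum_distrib_left sum_distrib_right)
    also have "\<dots> = (\<Sum>A\<in>UNIV. \<Sum>C\<in>UNIV. blade_sign C (sym_diff C D) *
        (blade_sign A (sym_diff A C) * coeff x A * coeff y (sym_diff A C)) * coeff z (sym_diff C D))"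
      by (rule sum.swap)
    also have "\<dots> = (\<Sum>A\<in>UNIV. \<Sum>B\<in>UNIV. blade_sign A (sym_diff A D) * coeff x A *
        (blade_sign B (sym_diff B (sym_diff A D)) * coeff y B * coeff z (sym_diff B (sym_diff A D))))"
    proof (rule sum.cong [OF refl], rule sum.reindex_bij_witness [of _ "sym_diff _" "sym_diff _"])
      fix A B C :: "'a set"
      have 1: "sym_diff A (sym_diff A X) = X" for X by auto
      show "sym_diff A (sym_diff A C) = C" "sym_diff A (sym_diff A B) = B" by (rule 1)+
      have 2: "sym_diff (sym_diff A C) (sym_diff A D) = sym_diff C D" by auto
      let ?E = "sym_diff C D" and ?B = "sym_diff A C"
      have C: "C = sym_diff A ?B" by auto
      have D: "sym_diff A D = sym_diff ?B ?E" by auto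
      have "blade_sign C ?E = blade_sign A ?E * blade_sign ?B ?E"
        using blade_sign_sym_diff_left [of A ?B ?E] C by simp
      moreover have "blade_sign A (sym_diff A D) = blade_sign A ?B * blade_sign A ?E"
        using blade_sign_sym_diff_right [of A ?B ?E] D by simp
      ultimately show "blade_sign A (sym_diff A D) * coeff x A *
          (blade_sign ?B (sym_diff ?B (sym_diff A D)) * coeff y ?B * coeff z (sym_diff ?B (sym_diff A D)))
        = blade_sign C ?E * (blade_sign A ?B * coeff x A * coeff y ?B) * coeff z ?E"
        unfolding 2 by (simp only: ac_simps)
    qed auto
    also have "\<dots> = coeff (x * (y * z)) D"
      by (simp add: times_clifford_def sum_distrib_left)
    finally show "coeff (x * y * z) D = coeff (x * (y * z)) D" .
  qed
  have eq: "(\<Sum>A\<in>UNIV. g A * (if A = {} then 1 else 0) * h A) = g {} * h {}"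
    for g h :: "'a set \<Rightarrow> real"
    by (subst sum.mono_neutral_cong_right [where S = "{{}}" and h = "\<lambda>A. g A * h A"]) auto
  show "1 * x = x"
    by (rule clifford_eqI) (simp add: times_clifford_def one_clifford_def eq)
  have eq': "(\<Sum>A\<in>UNIV. g A * h A * (if sym_diff A C = {} then 1 else 0)) = g C * h C"
    for g h :: "'a set \<Rightarrow> real" and C
    by (subst sum.mono_neutral_cong_right [where S = "{C}" and h = "\<lambda>A. g A * h A"]) auto
  show "x * 1 = x"
    by (rule clifford_eqI) (simp only: times_clifford_def one_clifford_def eq' coeff_Clifford; simp)
  show "(x + y) * z = x * z + y * z" "x * (y + z) = x * y + x * z"
    by (rule clifford_eqI, simp add: times_clifford_def algebra_simps sum.distrib)+
  show "r *\<^sub>R x * y = r *\<^sub>R (x * y)" "x * r *\<^sub>R y = r *\<^sub>R (x * y)"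
    by (rule clifford_eqI, simp add: times_clifford_def sum_distrib_left ac_simps)+
  have "coeff (0 :: 'a clifford) {} \<noteq> coeff 1 {}"
    by (simp add: one_clifford_def)
  then show "(0 :: 'a clifford) \<noteq> 1"
    by metis
qed

end

definition blade :: "'n set \<Rightarrow> 'n clifford" where
  "blade A = Clifford (\<lambda>B. if B = A then 1 else 0)"

definition gen :: "'n \<Rightarrow> 'n clifford" where
  "gen l = blade {l}"

text \<open>The Euclidean structure on the coordinates.\<close>

instantiation clifford :: (finite) euclidean_space
begin

definition "inner x y = (\<Sum>A\<in>UNIV. coeff x A * coeff y A)" for x y :: "'a clifford"
definition "norm x = sqrt (inner x x)" for x :: "'a clifford"
definition "sgn x = inverse (norm x) *\<^sub>R x" for x :: "'a clifford"
definition "dist x y = norm (x - y)" for x y :: "'a clifford"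
definition [code del]:
  "(uniformity :: ('a clifford \<times> 'a clifford) filter)
    = (INF e\<in>{0<..}. principal {(x, y). dist x y < e})"
definition [code del]:
  "open (U :: 'a clifford set) \<longleftrightarrow> (\<forall>x\<in>U. eventually (\<lambda>(x', y). x' = x \<longrightarrow> y \<in> U) uniformity)"
definition "(Basis :: 'a clifford set) = range blade"

instance
proof
  fix x y z :: "'a clifford" and r :: real
  show "inner x y = inner y x"
    by (simp add: inner_clifford_def mult.commute)
  show "inner (x + y) z = inner x z + inner y z"
    by (simp add: inner_clifford_def algebra_simps sum.distrib)
  show "inner (r *\<^sub>R x) y = r * inner x y"
    by (simp add: inner_clifford_def sum_distrib_left ac_simps)
  show "0 \<le> inner x x"
    by (simp add: inner_clifford_def sum_nonneg)
  show "inner x x = 0 \<longleftrightarrow> x = 0"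
    by (simp add: inner_clifford_def sum_nonneg_eq_0_iff clifford_eq_iff)
  have blade: "inner x (blade A) = coeff x A" for x :: "'a clifford" and A
    by (simp add: inner_clifford_def blade_def if_distrib [of "(*) _"] cong: if_cong)
  show "inner u v = (if u = v then 1 else 0)" if "u \<in> Basis" "v \<in> Basis" for u v :: "'a clifford"
    using that by (auto simp: Basis_clifford_def blade) (auto simp: blade_def)
  show "(\<forall>u\<in>Basis. inner x u = 0) \<longleftrightarrow> x = 0"
    by (auto simp: Basis_clifford_def blade clifford_eq_iff)
qed (simp_all add: norm_clifford_def sgn_clifford_def dist_clifford_def
      uniformity_clifford_def open_clifford_def Basis_clifford_def)

end

lemma blade_mult:
  "blade A * blade B = blade_sign A B *\<^sub>R blade (sym_diff A B)"
  for A B :: "'n::{finite,linorder} set"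
proof (rule clifford_eqI)
  fix C
  have "coeff (blade A * blade B) C
      = (\<Sum>D\<in>UNIV. if D = A then blade_sign A (sym_diff A C) * (if sym_diff A C = B then 1 else 0) else 0)"
    unfolding times_clifford_def coeff_Clifford by (rule sum.cong) (simp_all add: blade_def)
  also have "\<dots> = blade_sign A (sym_diff A C) * (if sym_diff A C = B then 1 else 0)"
    by simp
  also have "\<dots> = coeff (blade_sign A B *\<^sub>R blade (sym_diff A B)) C"
  proof -
    have "sym_diff A C = B \<longleftrightarrow> C = sym_diff A B" by blast
    then show ?thesis by (auto simp: blade_def)
  qed
  finally show "coeff (blade A * blade B) C = coeff (blade_sign A B *\<^sub>R blade (sym_diff A B)) C" .
qed

lemma blade_empty: "blade {} = (1 :: 'n::{finite,linorder} clifford)"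
  by (simp add: blade_def one_clifford_def)

lemma blade_singleton_sign: "blade_sign {l} {m} = (if m \<le> l then - 1 else 1)"
  for l m :: "'n::{finite,linorder}"
  by (simp add: blade_sign_prod)

lemma gen_square: "gen l * gen l = (- 1 :: 'n::{finite,linorder} clifford)"
  by (simp add: gen_def blade_mult blade_singleton_sign blade_empty)

lemma gen_anticommute: "l \<noteq> m \<Longrightarrow> gen l * gen m + gen m * gen l = 0"
  for l m :: "'n::{finite,linorder}"
proof -
  assume "l \<noteq> m"
  then have "sym_diff {l} {m} = {l, m}" "sym_diff {m} {l} = {l, m}" by auto
  then show ?thesis
    using \<open>l \<noteq> m\<close> by (auto simp: gen_def blade_mult blade_singleton_sign)
qed

lemma blade_insert_less:
  fixes A :: "'n::{finite,linorder} set"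
  assumes "\<And>a. a \<in> A \<Longrightarrow> l < a"
  shows "blade (insert l A) = gen l * blade A"
proof -
  have "l \<notin> A" using assms by blast
  then have "sym_diff {l} A = insert l A" by auto
  moreover have "blade_sign {l} A = 1"
    using assms by (auto simp: blade_sign_prod not_le intro!: prod.neutral)
  ultimately show ?thesis
    by (simp add: gen_def blade_mult)
qed


section \<open>Paravectors and axially symmetric sets\<close>

definition vec_part :: "'n::{finite,linorder} clifford \<Rightarrow> 'n clifford" where
  "vec_part x = (\<Sum>l\<in>UNIV. coeff x {l} *\<^sub>R gen l)"

definition re_part :: "'n::{finite,linorder} clifford \<Rightarrow> real" where
  "re_part x = coeff x {}"

text \<open>The image of the identification of \<open>\<real>\<^sup>n\<^sup>+\<^sup>1\<close> with a subspace of the algebra.\<close>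

definition paravectors :: "'n::{finite,linorder} clifford set" where
  "paravectors = {of_real a + (\<Sum>l\<in>UNIV. c l *\<^sub>R gen l) | a c. True}"

definition pconj :: "'n::{finite,linorder} clifford \<Rightarrow> 'n clifford" where
  "pconj x = of_real (re_part x) - vec_part x"

definition imag_sphere :: "'n::{finite,linorder} clifford set" where
  "imag_sphere = {\<Sum>l\<in>UNIV. c l *\<^sub>R gen l | c. (\<Sum>l\<in>UNIV. (c l)\<^sup>2) = 1}"

text \<open>The point \<open>u + j v\<close>.\<close>

definition slice_pt :: "'n::{finite,linorder} clifford \<Rightarrow> real \<Rightarrow> real \<Rightarrow> 'n clifford" where
  "slice_pt j u v = of_real u + v *\<^sub>R j"

definition ax_sphere :: "'n::{finite,linorder} clifford \<Rightarrow> 'n clifford set" where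
  "ax_sphere x = {slice_pt j (re_part x) (norm (vec_part x)) | j. j \<in> imag_sphere}"

definition axially_symmetric :: "'n::{finite,linorder} clifford set \<Rightarrow> bool" where
  "axially_symmetric U \<longleftrightarrow> U \<subseteq> paravectors \<and> (\<forall>x\<in>U. ax_sphere x \<subseteq> U)"

text \<open>Openness in \<open>\<real>\<^sup>n\<^sup>+\<^sup>1\<close>, that is, relative to the subspace of paravectors.\<close>

definition axially_symmetric_open :: "'n::{finite,linorder} clifford set \<Rightarrow> bool" where
  "axially_symmetric_open U \<longleftrightarrow>
     axially_symmetric U \<and> openin (top_of_set paravectors) U"


section \<open>Poly slice monogenic functions\<close>

definition stem_domain :: "'n::{finite,linorder} clifford set \<Rightarrow> (real \<times> real) set" where
  "stem_domain U = {(u, v). \<forall>j\<in>imag_sphere. slice_pt j u v \<in> U}"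

definition diff_u :: "(real \<times> real \<Rightarrow> 'b) \<Rightarrow> real \<times> real \<Rightarrow> 'b::real_normed_vector" where
  "diff_u f p = vector_derivative (\<lambda>t. f (t, snd p)) (at (fst p))"

definition diff_v :: "(real \<times> real \<Rightarrow> 'b) \<Rightarrow> real \<times> real \<Rightarrow> 'b::real_normed_vector" where
  "diff_v f p = vector_derivative (\<lambda>t. f (fst p, t)) (at (snd p))"

text \<open>The class \<open>C\<^sup>k\<close> on an open subset of the plane: all iterated partial derivatives up to
  order \<open>k\<close> exist and are continuous.\<close>

primrec class_C :: "nat \<Rightarrow> (real \<times> real) set \<Rightarrow> (real \<times> real \<Rightarrow> 'b::real_normed_vector) \<Rightarrow> bool"
where
  "class_C 0 S f \<longleftrightarrow> continuous_on S f"
| "class_C (Suc k) S f \<longleftrightarrow> continuous_on S f \<and>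
     (\<forall>p\<in>S. (\<lambda>t. f (t, snd p)) differentiable (at (fst p)) \<and>
             (\<lambda>t. f (fst p, t)) differentiable (at (snd p))) \<and>
     class_C k S (diff_u f) \<and> class_C k S (diff_v f)"

definition even_odd_pair ::
  "(real \<times> real) set \<Rightarrow> (real \<times> real \<Rightarrow> 'b::real_normed_vector) \<Rightarrow> (real \<times> real \<Rightarrow> 'b) \<Rightarrow> bool"
where
  "even_odd_pair S F0 F1 \<longleftrightarrow>
     (\<forall>(u, v)\<in>S. F0 (u, - v) = F0 (u, v) \<and> F1 (u, - v) = - F1 (u, v))"

definition CR_left :: "'n::{finite,linorder} clifford
    \<Rightarrow> (real \<times> real \<Rightarrow> 'n clifford) \<Rightarrow> real \<times> real \<Rightarrow> 'n clifford" where
  "CR_left j G p = diff_u G p + j * diff_v G p"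

definition CR_right :: "'n::{finite,linorder} clifford
    \<Rightarrow> (real \<times> real \<Rightarrow> 'n clifford) \<Rightarrow> real \<times> real \<Rightarrow> 'n clifford" where
  "CR_right j G p = diff_u G p + diff_v G p * j"

definition left_poly_slice_monogenic ::
  "nat \<Rightarrow> 'n::{finite,linorder} clifford set \<Rightarrow> ('n clifford \<Rightarrow> 'n clifford) \<Rightarrow> bool" where
  "left_poly_slice_monogenic M U F \<longleftrightarrow>
     (\<exists>F0 F1. even_odd_pair (stem_domain U) F0 F1 \<and>
        class_C M (stem_domain U) F0 \<and> class_C M (stem_domain U) F1 \<and>
        (\<forall>j\<in>imag_sphere. \<forall>(u, v)\<in>stem_domain U.
           F (slice_pt j u v) = F0 (u, v) + j * F1 (u, v) \<and>
           (1 / 2 ^ M) *\<^sub>R (CR_left j ^^ M) (\<lambda>p. F0 p + j * F1 p) (u, v) = 0))"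

definition right_poly_slice_monogenic ::
  "nat \<Rightarrow> 'n::{finite,linorder} clifford set \<Rightarrow> ('n clifford \<Rightarrow> 'n clifford) \<Rightarrow> bool" where
  "right_poly_slice_monogenic M U F \<longleftrightarrow>
     (\<exists>F0 F1. even_odd_pair (stem_domain U) F0 F1 \<and>
        class_C M (stem_domain U) F0 \<and> class_C M (stem_domain U) F1 \<and>
        (\<forall>j\<in>imag_sphere. \<forall>(u, v)\<in>stem_domain U.
           F (slice_pt j u v) = F0 (u, v) + F1 (u, v) * j \<and>
           (1 / 2 ^ M) *\<^sub>R (CR_right j ^^ M) (\<lambda>p. F0 p + F1 p * j) (u, v) = 0))"

abbreviation left_slice_monogenic ::
  "'n::{finite,linorder} clifford set \<Rightarrow> ('n clifford \<Rightarrow> 'n clifford) \<Rightarrow> bool" where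
  "left_slice_monogenic \<equiv> left_poly_slice_monogenic 1"

abbreviation right_slice_monogenic ::
  "'n::{finite,linorder} clifford set \<Rightarrow> ('n clifford \<Rightarrow> 'n clifford) \<Rightarrow> bool" where
  "right_slice_monogenic \<equiv> right_poly_slice_monogenic 1"

definition left_components :: "nat \<Rightarrow> 'n::{finite,linorder} clifford set
    \<Rightarrow> ('n clifford \<Rightarrow> 'n clifford) \<Rightarrow> (nat \<Rightarrow> 'n clifford \<Rightarrow> 'n clifford) \<Rightarrow> bool" where
  "left_components M U F f \<longleftrightarrow> (\<forall>k<M. left_slice_monogenic U (f k)) \<and>
     (\<forall>x\<in>U. F x = (\<Sum>k<M. pconj x ^ k * f k x))"

definition right_components :: "nat \<Rightarrow> 'n::{finite,linorder} clifford set
    \<Rightarrow> ('n clifford \<Rightarrow> 'n clifford) \<Rightarrow> (nat \<Rightarrow> 'n clifford \<Rightarrow> 'n clifford) \<Rightarrow> bool" where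
  "right_components M U F f \<longleftrightarrow> (\<forall>k<M. right_slice_monogenic U (f k)) \<and>
     (\<forall>x\<in>U. F x = (\<Sum>k<M. f k x * pconj x ^ k))"


section \<open>Cauchy kernels\<close>

text \<open>The two-sided inverse; it is unique when it exists, and unspecified otherwise.\<close>

definition cl_inverse :: "'n::{finite,linorder} clifford \<Rightarrow> 'n clifford" where
  "cl_inverse a = (THE b. a * b = 1 \<and> b * a = 1)"

definition S_L :: "'n::{finite,linorder} clifford \<Rightarrow> 'n clifford \<Rightarrow> 'n clifford" where
  "S_L s x = - (cl_inverse (x\<^sup>2 - (2 * re_part s) *\<^sub>R x + of_real ((norm s)\<^sup>2)) * (x - pconj s))"

definition S_R :: "'n::{finite,linorder} clifford \<Rightarrow> 'n clifford \<Rightarrow> 'n clifford" where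
  "S_R s x = - ((x - pconj s) * cl_inverse (x\<^sup>2 - (2 * re_part s) *\<^sub>R x + of_real ((norm s)\<^sup>2)))"


section \<open>Slice Cauchy domains and integrals over their boundaries\<close>

text \<open>\<open>U \<inter> \<complex>\<^sub>j\<close>, with \<open>\<complex>\<^sub>j\<close> identified with the complex plane through \<open>u + j v \<mapsto> u + \<i> v\<close>.\<close>

definition slice_section ::
  "'n::{finite,linorder} clifford \<Rightarrow> 'n clifford set \<Rightarrow> complex set" where
  "slice_section j U = {z. slice_pt j (Re z) (Im z) \<in> U}"

text \<open>
  A Jordan curve bounding \<open>D\<close> is positively oriented with respect to \<open>D\<close> if \<open>D\<close> lies on its
  left: it runs counterclockwise if \<open>D\<close> is, near the curve, the inside of the curve, and
  clockwise if \<open>D\<close> is, near the curve, its outside.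
\<close>

definition positively_oriented_wrt :: "complex set \<Rightarrow> (real \<Rightarrow> complex) \<Rightarrow> bool" where
  "positively_oriented_wrt D \<gamma> \<longleftrightarrow> (\<exists>N. open N \<and> path_image \<gamma> \<subseteq> N \<and>
     (D \<inter> N = inside (path_image \<gamma>) \<inter> N \<and>
        (\<forall>z\<in>inside (path_image \<gamma>). winding_number \<gamma> z = 1) \<or>
      D \<inter> N = outside (path_image \<gamma>) \<inter> N \<and>
        (\<forall>z\<in>inside (path_image \<gamma>). winding_number \<gamma> z = - 1)))"

text \<open>\<open>\<Gamma>\<close> is a family of piecewise continuously differentiable Jordan curves that parametrizes
  the positively oriented boundary of \<open>D\<close>.\<close>

definition oriented_boundary :: "complex set \<Rightarrow> (real \<Rightarrow> complex) set \<Rightarrow> bool" where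
  "oriented_boundary D \<Gamma> \<longleftrightarrow> finite \<Gamma> \<and>
     (\<forall>\<gamma>\<in>\<Gamma>. simple_path \<gamma> \<and> pathfinish \<gamma> = pathstart \<gamma> \<and> valid_path \<gamma> \<and>
        positively_oriented_wrt D \<gamma>) \<and>
     pairwise (\<lambda>\<gamma> \<delta>. disjnt (path_image \<gamma>) (path_image \<delta>)) \<Gamma> \<and>
     frontier D = (\<Union>\<gamma>\<in>\<Gamma>. path_image \<gamma>)"

definition slice_cauchy_domain :: "'n::{finite,linorder} clifford set \<Rightarrow> bool" where
  "slice_cauchy_domain U \<longleftrightarrow> axially_symmetric_open U \<and>
     (\<forall>j\<in>imag_sphere. \<exists>\<Gamma>. oriented_boundary (slice_section j U) \<Gamma>)"

definition slice_path ::
  "'n::{finite,linorder} clifford \<Rightarrow> (real \<Rightarrow> complex) \<Rightarrow> real \<Rightarrow> 'n clifford" where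
  "slice_path j \<gamma> t = slice_pt j (Re (\<gamma> t)) (Im (\<gamma> t))"

text \<open>
  As multiplication is not commutative, the integrand is a function \<open>\<omega> s ds\<^sub>j\<close> of the point and
  of the line element \<open>ds\<^sub>j = ds (-j)\<close>; along a curve \<open>s(t)\<close>, \<open>ds\<^sub>j\<close> stands for
  \<open>s'(t) (-j) dt\<close>.
\<close>

definition slice_integrand :: "'n::{finite,linorder} clifford
    \<Rightarrow> ('n clifford \<Rightarrow> 'n clifford \<Rightarrow> 'n clifford) \<Rightarrow> (real \<Rightarrow> complex) \<Rightarrow> real \<Rightarrow> 'n clifford" where
  "slice_integrand j \<omega> \<gamma> t =
     \<omega> (slice_path j \<gamma> t) (vector_derivative (slice_path j \<gamma>) (at t within {0..1}) * (- j))"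

definition slice_integrable :: "'n::{finite,linorder} clifford
    \<Rightarrow> (real \<Rightarrow> complex) set \<Rightarrow> ('n clifford \<Rightarrow> 'n clifford \<Rightarrow> 'n clifford) \<Rightarrow> bool" where
  "slice_integrable j \<Gamma> \<omega> \<longleftrightarrow> (\<forall>\<gamma>\<in>\<Gamma>. slice_integrand j \<omega> \<gamma> integrable_on {0..1})"

definition slice_integral :: "'n::{finite,linorder} clifford
    \<Rightarrow> (real \<Rightarrow> complex) set \<Rightarrow> ('n clifford \<Rightarrow> 'n clifford \<Rightarrow> 'n clifford) \<Rightarrow> 'n clifford" where
  "slice_integral j \<Gamma> \<omega> = (\<Sum>\<gamma>\<in>\<Gamma>. integral {0..1} (slice_integrand j \<omega> \<gamma>))"

end

theory Submission
  imports Defs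
begin

text \<open>
  The powers of \<open>pconj x\<close> are constants for the integration, so everything follows from Cauchy's
  formula \<open>2 \<pi> f x = \<integral> S_L s x ds\<^sub>j f s\<close> for a single slice monogenic function \<open>f\<close> and its mirror
  image; that the integral depends neither on \<open>U\<close> nor on \<open>j\<close> is then clear, because its value
  \<open>2 \<pi> F x\<close> does not.

  On the slice of \<open>j\<close>, the function \<open>f\<close> is holomorphic with values in the algebra, made a complex
  vector space by left multiplication with \<open>j\<close>. Composing with complex linear functionals gives
  the classical Cauchy formula for points \<open>z\<close> of that slice
  (\<open>Cauchy_formula_complex_structure\<close>). A point \<open>x = u + i v\<close> in another slice is reached by the
  representation formula: with \<open>z = u + j v\<close>,
  \<open>2 f x = (1 - i j) f z + (1 + i j) f (cnj z)\<close>. The noncommutative kernel \<open>S_L s x\<close> is the same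
  combination of the complex kernels \<open>1 / (s - z)\<close> and \<open>1 / (s - cnj z)\<close>
  (\<open>S_L_eq_complex_kernels\<close>), and both \<open>z\<close> and \<open>cnj z\<close> lie in the section of \<open>U\<close> by axial symmetry.

  The classical formula is needed for a domain bounded by several oriented Jordan curves, in an
  open set that need not be connected. The orientation condition is local, near each curve; the
  global fact behind it is that the winding numbers add up to \<open>1\<close> on the domain and to \<open>0\<close> off its
  closure (\<open>winding_number_sum_oriented_boundary\<close>). Within one component of the open set the curves
  are then joined to a single closed curve (\<open>closed_paths_join\<close>), which is homologous to zero.
\<close>

section \<open>Cauchy's formula for domains bounded by several curves\<close>

text \<open>
  The difference between the sum of the winding numbers and the indicator function of \<open>D\<close> is
  constant off the boundary: on crossing a boundary curve \<open>\<gamma>\<close> the orientation makes the winding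
  number of \<open>\<gamma>\<close> and the indicator function jump by the same amount, while the other winding numbers
  do not change. The difference therefore extends over the boundary to a locally constant function
  on the plane, and it vanishes far away because \<open>D\<close> is bounded.
\<close>

lemma winding_number_sum_oriented_boundary:
  assumes \<Gamma>: "oriented_boundary D \<Gamma>" and D: "bounded D" and w: "w \<notin> frontier D"
  shows "(\<Sum>\<gamma>\<in>\<Gamma>. winding_number \<gamma> w) = (if w \<in> D then 1 else 0)"
proof -
  define ind :: "complex \<Rightarrow> complex" where "ind w = (if w \<in> D then 1 else 0)" for w
  have fin: "finite \<Gamma>" and fr: "frontier D = (\<Union>\<gamma>\<in>\<Gamma>. path_image \<gamma>)"
    using \<Gamma> by (auto simp: oriented_boundary_def)
  have pa: "path \<gamma>" "pathfinish \<gamma> = pathstart \<gamma>" "positively_oriented_wrt D \<gamma>" if "\<gamma> \<in> \<Gamma>" for \<gamma>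
    using \<Gamma> that by (auto simp: oriented_boundary_def simple_path_def)
  have disj: "\<delta> = \<gamma>" if "\<gamma> \<in> \<Gamma>" "\<delta> \<in> \<Gamma>" "x \<in> path_image \<gamma>" "x \<in> path_image \<delta>" for \<gamma> \<delta> x
    using \<Gamma> that unfolding oriented_boundary_def pairwise_def disjnt_def by blast
  \<comment> \<open>The jumps cancel: the difference is \<open>0\<close> on both sides if \<open>D\<close> lies inside \<open>\<gamma>\<close>,
    and \<open>-1\<close> on both sides if \<open>D\<close> lies outside.\<close>
  have jump: "\<exists>N c. open N \<and> path_image \<gamma> \<subseteq> N \<and>
      (\<forall>w \<in> N - path_image \<gamma>. winding_number \<gamma> w - ind w = c)" if g: "\<gamma> \<in> \<Gamma>" for \<gamma>
  proof -
    have io: "w \<in> inside (path_image \<gamma>) \<longleftrightarrow> w \<notin> outside (path_image \<gamma>)" if "w \<notin> path_image \<gamma>" for w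
      using that inside_Un_outside[of "path_image \<gamma>"] inside_Int_outside[of "path_image \<gamma>"] by blast
    have z: "winding_number \<gamma> w = 0" if "w \<in> outside (path_image \<gamma>)" for w
      using winding_number_zero_in_outside[OF pa(1,2)[OF g] that] .
    obtain N where N: "open N" "path_image \<gamma> \<subseteq> N" and
      "(D \<inter> N = inside (path_image \<gamma>) \<inter> N \<and>
        (\<forall>z\<in>inside (path_image \<gamma>). winding_number \<gamma> z = 1) \<or>
       D \<inter> N = outside (path_image \<gamma>) \<inter> N \<and>
        (\<forall>z\<in>inside (path_image \<gamma>). winding_number \<gamma> z = - 1))"
      using pa(3)[OF g] unfolding positively_oriented_wrt_def by blast
    then consider
        "D \<inter> N = inside (path_image \<gamma>) \<inter> N" "\<forall>z\<in>inside (path_image \<gamma>). winding_number \<gamma> z = 1"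
      | "D \<inter> N = outside (path_image \<gamma>) \<inter> N" "\<forall>z\<in>inside (path_image \<gamma>). winding_number \<gamma> z = - 1"
      by blast
    then show ?thesis
    proof cases
      case 1
      have "winding_number \<gamma> w - ind w = 0" if "w \<in> N - path_image \<gamma>" for w
      proof (cases "w \<in> inside (path_image \<gamma>)")
        case True then show ?thesis using 1 that by (auto simp: ind_def)
      next
        case False
        then have "w \<notin> D" using 1 that by auto
        then show ?thesis using False z[of w] io[of w] that by (auto simp: ind_def)
      qed
      then show ?thesis using N by blast
    next
      case 2
      have "winding_number \<gamma> w - ind w = -1" if "w \<in> N - path_image \<gamma>" for w
      proof (cases "w \<in> inside (path_image \<gamma>)")
        case True
        then have "w \<notin> D" using 2 that io[of w] by auto
        then show ?thesis using True 2 by (auto simp: ind_def)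
      next
        case False
        then have "w \<in> D" using 2 that io[of w] by auto
        then show ?thesis using False z[of w] io[of w] that by (auto simp: ind_def)
      qed
      then show ?thesis using N by blast
    qed
  qed
  obtain N c where N: "\<And>\<gamma>. \<gamma> \<in> \<Gamma> \<Longrightarrow> open (N \<gamma>)" "\<And>\<gamma>. \<gamma> \<in> \<Gamma> \<Longrightarrow> path_image \<gamma> \<subseteq> N \<gamma>"
    and c: "\<And>\<gamma> w. \<gamma> \<in> \<Gamma> \<Longrightarrow> w \<in> N \<gamma> - path_image \<gamma> \<Longrightarrow> winding_number \<gamma> w - ind w = c \<gamma>"
    using jump by metis
  \<comment> \<open>The extension: on \<open>\<gamma>\<close> itself the contribution of \<open>\<gamma>\<close> is its common value \<open>c \<gamma>\<close>
    on the two sides.\<close>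
  define h where "h w = (if w \<in> frontier D
      then (let \<gamma> = (THE \<gamma>. \<gamma> \<in> \<Gamma> \<and> w \<in> path_image \<gamma>)
            in c \<gamma> + (\<Sum>\<delta>\<in>\<Gamma> - {\<gamma>}. winding_number \<delta> w))
      else (\<Sum>\<gamma>\<in>\<Gamma>. winding_number \<gamma> w) - ind w)" for w
  define L where "L a \<delta> = {w. w \<notin> path_image \<delta> \<and> winding_number \<delta> w = winding_number \<delta> a}" for a \<delta>
  have opL: "open (L a \<delta>)" if "\<delta> \<in> \<Gamma>" for a \<delta>
    unfolding L_def by (intro open_winding_number_levelsets pa that)
  have "h constant_on UNIV"
  proof (rule locally_constant_imp_constant)
    fix a :: complex
    have "\<exists>T. open T \<and> a \<in> T \<and> (\<forall>x\<in>T. h x = h a)"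
    proof (cases "a \<in> frontier D")
      case True
      then obtain \<gamma> where g: "\<gamma> \<in> \<Gamma>" "a \<in> path_image \<gamma>" using fr by blast
      define T where "T = N \<gamma> \<inter> (\<Inter>\<delta>\<in>\<Gamma> - {\<gamma>}. L a \<delta>)"
      have "open T" unfolding T_def using fin N g opL by (intro open_Int open_INT) auto
      moreover have aT: "a \<in> T" using g N disj by (auto simp: T_def L_def)
      moreover have "h w = c \<gamma> + (\<Sum>\<delta>\<in>\<Gamma> - {\<gamma>}. winding_number \<delta> a)" if w: "w \<in> T" for w
      proof -
        have eq: "(\<Sum>\<delta>\<in>\<Gamma> - {\<gamma>}. winding_number \<delta> w) = (\<Sum>\<delta>\<in>\<Gamma> - {\<gamma>}. winding_number \<delta> a)"
          using w by (intro sum.cong) (auto simp: T_def L_def)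
        show ?thesis
        proof (cases "w \<in> path_image \<gamma>")
          case True
          then have "(THE \<gamma>. \<gamma> \<in> \<Gamma> \<and> w \<in> path_image \<gamma>) = \<gamma>" using g disj by blast
          then show ?thesis using True g fr eq by (auto simp: h_def)
        next
          case False
          then have "w \<notin> frontier D" using w fr by (auto simp: T_def L_def)
          then have "h w = (winding_number \<gamma> w - ind w) + (\<Sum>\<delta>\<in>\<Gamma> - {\<gamma>}. winding_number \<delta> w)"
            by (simp add: h_def sum.remove[OF fin g(1)])
          then show ?thesis using c[OF g(1), of w] False w eq by (simp add: T_def)
        qed
      qed
      ultimately show ?thesis by metis
    next
      case False
      define T where "T = (interior D \<union> - closure D) \<inter> (if a \<in> D then interior D else - closure D)
         \<inter> (\<Inter>\<delta>\<in>\<Gamma>. L a \<delta>)"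
      have "open T" unfolding T_def using fin opL by (intro open_Int open_INT) auto
      moreover have "a \<in> T"
        using False fr closure_subset[of D] interior_subset[of D] by (auto simp: T_def L_def frontier_def)
      moreover have "h w = h a" if w: "w \<in> T" for w
      proof -
        have "w \<notin> frontier D" using w by (auto simp: T_def frontier_def)
        moreover have "ind w = ind a"
          using w interior_subset[of D] closure_subset[of D] by (auto simp: T_def ind_def split: if_splits)
        moreover have "(\<Sum>\<delta>\<in>\<Gamma>. winding_number \<delta> w) = (\<Sum>\<delta>\<in>\<Gamma>. winding_number \<delta> a)"
          using w by (intro sum.cong) (auto simp: T_def L_def)
        ultimately show ?thesis using False by (simp add: h_def)
      qed
      ultimately show ?thesis by metis
    qed
    then show "\<exists>T. openin (top_of_set UNIV) T \<and> a \<in> T \<and> (\<forall>x\<in>T. h x = h a)" by simp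
  qed (rule connected_UNIV)
  then obtain k where k: "\<And>w. h w = k" by (auto simp: constant_on_def)
  obtain B where B: "closure D \<subseteq> ball 0 B"
    using bounded_subset_ballD[of "closure D" 0] D by auto
  obtain v :: complex where v: "v \<notin> ball 0 B"
    by (metis bounded_ball not_bounded_UNIV UNIV_eq_I)
  have "winding_number \<gamma> v = 0" if "\<gamma> \<in> \<Gamma>" for \<gamma>
  proof (rule winding_number_zero_outside[of _ "ball 0 B"])
    show "path_image \<gamma> \<subseteq> ball 0 B" using that fr B by (auto simp: frontier_def)
  qed (use pa that v in auto)
  moreover have "v \<notin> closure D" using v B by blast
  then have "v \<notin> D" "v \<notin> frontier D" using closure_subset by (auto simp: frontier_def)
  ultimately have "k = 0" using k[of v] by (simp add: h_def ind_def)
  then show ?thesis using k[of w] w by (simp add: h_def ind_def split: if_splits)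
qed

text \<open>
  A component \<open>C\<close> of \<open>S\<close> is relatively clopen in \<open>S\<close>, so that cutting \<open>D\<close> down to \<open>C\<close> creates no new
  boundary. This reduces statements about cycles in an open set to cycles in a connected one.
\<close>

lemma oriented_boundary_Int_component:
  assumes \<Gamma>: "oriented_boundary D \<Gamma>" and sub: "closure D \<subseteq> S" and S: "open S"
    and C: "C \<in> components S"
  shows "oriented_boundary (D \<inter> C) {\<gamma>\<in>\<Gamma>. path_image \<gamma> \<subseteq> C}"
proof -
  have fr: "frontier D = (\<Union>\<gamma>\<in>\<Gamma>. path_image \<gamma>)"
    using \<Gamma> by (auto simp: oriented_boundary_def)
  have opC: "open C" using S C by (rule open_components)
  have opR: "open (S - C)"
  proof -
    have "S - C = \<Union>(components S - {C})"
      using Union_components[of S] components_nonoverlap C by blast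
    then show ?thesis using S by (auto intro!: open_Union dest: open_components)
  qed
  have "closure (D \<inter> C) = closure D \<inter> C"
  proof
    have "D \<inter> C \<subseteq> - (S - C)" by blast
    then have "closure (D \<inter> C) \<subseteq> - (S - C)"
      using opR closed_Compl[of "S - C"] by (intro closure_minimal)
    moreover have "closure (D \<inter> C) \<subseteq> closure D" by (rule closure_mono) blast
    ultimately show "closure (D \<inter> C) \<subseteq> closure D \<inter> C" using sub by blast
    show "closure D \<inter> C \<subseteq> closure (D \<inter> C)"
      using open_Int_closure_subset[OF opC, of D] by (simp add: Int_commute)
  qed
  then have frC: "frontier (D \<inter> C) = frontier D \<inter> C"
    using interior_open[OF opC] by (auto simp: frontier_def)
  have alt: "path_image \<gamma> \<subseteq> C" if "\<gamma> \<in> \<Gamma>" "path_image \<gamma> \<inter> C \<noteq> {}" for \<gamma>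
  proof -
    have "path_image \<gamma> \<subseteq> S" using fr that sub by (auto simp: frontier_def)
    moreover have "connected (path_image \<gamma>)"
      using \<Gamma> that by (auto simp: oriented_boundary_def simple_path_def intro: connected_path_image)
    ultimately show ?thesis using components_maximal[OF C] that(2) by blast
  qed
  have "frontier (D \<inter> C) = (\<Union>\<gamma>\<in>{\<gamma>\<in>\<Gamma>. path_image \<gamma> \<subseteq> C}. path_image \<gamma>)"
    unfolding frC fr using alt by blast
  moreover have "positively_oriented_wrt (D \<inter> C) \<gamma>" if "\<gamma> \<in> \<Gamma>" "path_image \<gamma> \<subseteq> C" for \<gamma>
  proof -
    have "positively_oriented_wrt D \<gamma>" using \<Gamma> that by (auto simp: oriented_boundary_def)
    then obtain N where "open N" "path_image \<gamma> \<subseteq> N" and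
      *: "(D \<inter> N = inside (path_image \<gamma>) \<inter> N \<and>
        (\<forall>z\<in>inside (path_image \<gamma>). winding_number \<gamma> z = 1) \<or>
       D \<inter> N = outside (path_image \<gamma>) \<inter> N \<and>
        (\<forall>z\<in>inside (path_image \<gamma>). winding_number \<gamma> z = - 1))"
      unfolding positively_oriented_wrt_def by blast
    then have "open (N \<inter> C)" "path_image \<gamma> \<subseteq> N \<inter> C" using opC that by auto
    moreover have "D \<inter> C \<inter> (N \<inter> C) = X \<inter> (N \<inter> C)" if "D \<inter> N = X \<inter> N" for X
      using that by blast
    ultimately show ?thesis using * unfolding positively_oriented_wrt_def by metis
  qed
  ultimately show ?thesis
    using \<Gamma> unfolding oriented_boundary_def by (auto intro: pairwise_subset)
qed

text \<open>
  Every closed curve can be reached from the base point \<open>a\<close> by a path inside \<open>C\<close>; walking along this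
  path, around the curve and back adds precisely the integral around the curve, since the two passages
  of the connecting path cancel. In this way a cycle is replaced by one closed curve, to which
  the homology version of Cauchy's theorem for single curves applies.
\<close>

lemma closed_paths_join:
  assumes C: "open C" "connected C" and a: "a \<in> C" and fin: "finite \<Gamma>"
    and \<Gamma>: "\<And>\<gamma>. \<gamma> \<in> \<Gamma> \<Longrightarrow> valid_path \<gamma> \<and> pathfinish \<gamma> = pathstart \<gamma> \<and> path_image \<gamma> \<subseteq> C"
  shows "\<exists>p. valid_path p \<and> pathstart p = a \<and> pathfinish p = a \<and> path_image p \<subseteq> C \<and>
    (\<forall>f. f holomorphic_on C \<longrightarrow> contour_integral p f = (\<Sum>\<gamma>\<in>\<Gamma>. contour_integral \<gamma> f))"
  using fin \<Gamma>
proof (induction \<Gamma> rule: finite_induct)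
  case empty
  show ?case using a by (intro exI[of _ "linepath a a"]) (auto simp del: linepath_trivial simp: contour_integral_trivial)
next
  case (insert \<gamma> \<Gamma>)
  then obtain p where p: "valid_path p" "pathstart p = a" "pathfinish p = a" "path_image p \<subseteq> C"
    "\<And>f. f holomorphic_on C \<Longrightarrow> contour_integral p f = (\<Sum>\<gamma>\<in>\<Gamma>. contour_integral \<gamma> f)"
    by auto
  have g: "valid_path \<gamma>" "pathfinish \<gamma> = pathstart \<gamma>" "path_image \<gamma> \<subseteq> C"
    using insert.prems by auto
  then have "pathstart \<gamma> \<in> C" using pathstart_in_path_image by blast
  then obtain q where "polynomial_function q" "path_image q \<subseteq> C" "pathstart q = a" "pathfinish q = pathstart \<gamma>"
    using connected_open_polynomial_connected[OF C a] by blast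
  then have q: "valid_path q" "path_image q \<subseteq> C" "pathstart q = a" "pathfinish q = pathstart \<gamma>"
    by (auto simp: valid_path_polynomial_function)
  let ?r = "p +++ (q +++ (\<gamma> +++ reversepath q))"
  have "contour_integral ?r f = (\<Sum>\<gamma>\<in>insert \<gamma> \<Gamma>. contour_integral \<gamma> f)" if f: "f holomorphic_on C" for f
  proof -
    have int: "f contour_integrable_on r" if "valid_path r" "path_image r \<subseteq> C" for r
      using contour_integrable_holomorphic_simple[OF f C(1) that] .
    have "contour_integral ?r f = contour_integral p f + (contour_integral q f +
        (contour_integral \<gamma> f + contour_integral (reversepath q) f))"
      using p q g by (simp add: int contour_integral_join contour_integrable_reversepath)
    then show ?thesis
      using p q g f insert.hyps by (simp add: contour_integral_reversepath)
  qed
  moreover have "valid_path ?r" "pathstart ?r = a" "pathfinish ?r = a" "path_image ?r \<subseteq> C"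
    using p q g by (auto simp: path_image_join valid_path_join)
  ultimately show ?case by blast
qed

lemma Cauchy_theorem_connected_cycle:
  assumes C: "open C" "connected C" and f: "f holomorphic_on C" and fin: "finite \<Gamma>"
    and \<Gamma>: "\<And>\<gamma>. \<gamma> \<in> \<Gamma> \<Longrightarrow> valid_path \<gamma> \<and> pathfinish \<gamma> = pathstart \<gamma> \<and> path_image \<gamma> \<subseteq> C"
    and zero: "\<And>w. w \<notin> C \<Longrightarrow> (\<Sum>\<gamma>\<in>\<Gamma>. winding_number \<gamma> w) = 0"
  shows "(\<Sum>\<gamma>\<in>\<Gamma>. contour_integral \<gamma> f) = 0"
proof (cases "\<Gamma> = {}")
  case False
  then obtain a where a: "a \<in> C" using \<Gamma> pathstart_in_path_image by blast
  obtain p where p: "valid_path p" "pathstart p = a" "pathfinish p = a" "path_image p \<subseteq> C"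
    and eq: "\<And>f. f holomorphic_on C \<Longrightarrow> contour_integral p f = (\<Sum>\<gamma>\<in>\<Gamma>. contour_integral \<gamma> f)"
    using closed_paths_join[OF C a fin \<Gamma>] by blast
  have "winding_number p w = 0" if w: "w \<notin> C" for w
  proof -
    have "(\<lambda>z. 1 / (z - w)) holomorphic_on C"
      using w by (intro holomorphic_intros) auto
    then have "winding_number p w = (\<Sum>\<gamma>\<in>\<Gamma>. 1/(2*pi*\<i>) * contour_integral \<gamma> (\<lambda>z. 1 / (z - w)))"
      using p w by (subst winding_number_valid_path) (auto simp: eq sum_distrib_left)
    also have "\<dots> = (\<Sum>\<gamma>\<in>\<Gamma>. winding_number \<gamma> w)"
      using \<Gamma> w by (intro sum.cong refl, subst winding_number_valid_path) auto
    finally show ?thesis using zero w by simp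
  qed
  then have "(f has_contour_integral 0) p"
    using p by (intro Cauchy_theorem_global[OF C(1) f]) auto
  then show ?thesis using eq[OF f] by (simp add: contour_integral_unique)
qed simp

text \<open>
  The curves are grouped by the component of \<open>S\<close> that contains them. Those in a component \<open>C\<close> bound
  \<open>D \<inter> C\<close>, so that their winding numbers add up to zero outside \<open>C\<close>. The grouping is necessary:
  the curves of \<open>\<Gamma>\<close> can be joined to one curve only within a connected set.
\<close>

theorem Cauchy_theorem_oriented_boundary:
  assumes \<Gamma>: "oriented_boundary D \<Gamma>" and D: "bounded D" "closure D \<subseteq> S"
    and S: "open S" and f: "f holomorphic_on S"
  shows "(\<Sum>\<gamma>\<in>\<Gamma>. contour_integral \<gamma> f) = 0"
proof -
  have fin: "finite \<Gamma>" and fr: "frontier D = (\<Union>\<gamma>\<in>\<Gamma>. path_image \<gamma>)"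
    and val: "\<And>\<gamma>. \<gamma> \<in> \<Gamma> \<Longrightarrow> valid_path \<gamma> \<and> pathfinish \<gamma> = pathstart \<gamma>"
    using \<Gamma> by (auto simp: oriented_boundary_def)
  have im: "path_image \<gamma> \<subseteq> S" if "\<gamma> \<in> \<Gamma>" for \<gamma>
    using that fr D by (auto simp: frontier_def)
  define K where "K \<gamma> = connected_component_set S (pathstart \<gamma>)" for \<gamma>
  have K: "K \<gamma> \<in> components S \<and> path_image \<gamma> \<subseteq> K \<gamma>" if g: "\<gamma> \<in> \<Gamma>" for \<gamma>
  proof
    show "K \<gamma> \<in> components S" unfolding K_def
      using im[OF g] pathstart_in_path_image by (intro componentsI) blast
    show "path_image \<gamma> \<subseteq> K \<gamma>" unfolding K_def
      using im[OF g] val[OF g] by (intro connected_component_maximal)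
        (auto intro: connected_path_image valid_path_imp_path)
  qed
  have "(\<Sum>\<gamma>\<in>{\<gamma>\<in>\<Gamma>. K \<gamma> = C}. contour_integral \<gamma> f) = 0" if "C \<in> K ` \<Gamma>" for C
  proof -
    have C: "C \<in> components S" using that K by blast
    have eq: "{\<gamma>\<in>\<Gamma>. K \<gamma> = C} = {\<gamma>\<in>\<Gamma>. path_image \<gamma> \<subseteq> C}"
    proof -
      have "K \<gamma> = C" if "\<gamma> \<in> \<Gamma>" "path_image \<gamma> \<subseteq> C" for \<gamma>
        using K[OF that(1)] C that(2) pathstart_in_path_image[of \<gamma>]
          components_nonoverlap[of "K \<gamma>" S C] by blast
      then show ?thesis using K by blast
    qed
    have ob: "oriented_boundary (D \<inter> C) {\<gamma>\<in>\<Gamma>. path_image \<gamma> \<subseteq> C}"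
      by (rule oriented_boundary_Int_component[OF \<Gamma> D(2) S C])
    have opC: "open C" using S C by (rule open_components)
    show ?thesis unfolding eq
    proof (rule Cauchy_theorem_connected_cycle[OF opC])
      show "connected C" using C by (rule in_components_connected)
      show "f holomorphic_on C" using f holomorphic_on_subset in_components_subset[OF C] by blast
      fix w assume "w \<notin> C"
      moreover have "frontier (D \<inter> C) \<subseteq> C" using ob unfolding oriented_boundary_def by blast
      ultimately show "(\<Sum>\<gamma> | \<gamma> \<in> \<Gamma> \<and> path_image \<gamma> \<subseteq> C. winding_number \<gamma> w) = 0"
        using winding_number_sum_oriented_boundary[OF ob, of w] D(1) by auto
    qed (use fin val in auto)
  qed
  then show ?thesis
    by (subst sum.image_gen[OF fin, of _ K]) (auto intro: sum.neutral)
qed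

text \<open>
  Cauchy's theorem applies to the difference quotient of \<open>g\<close> at \<open>z\<close>, whose singularity is removable;
  what is left over is \<open>g z\<close> times the sum of the winding numbers around \<open>z\<close>, which is \<open>1\<close>.
\<close>

theorem Cauchy_formula_oriented_boundary:
  assumes \<Gamma>: "oriented_boundary D \<Gamma>" and D: "open D" "bounded D" "closure D \<subseteq> S"
    and S: "open S" and g: "g holomorphic_on S" and z: "z \<in> D"
  shows "(\<Sum>\<gamma>\<in>\<Gamma>. contour_integral \<gamma> (\<lambda>w. g w / (w - z))) = 2 * pi * \<i> * g z"
proof -
  have fr: "frontier D = (\<Union>\<gamma>\<in>\<Gamma>. path_image \<gamma>)"
    and val: "\<And>\<gamma>. \<gamma> \<in> \<Gamma> \<Longrightarrow> valid_path \<gamma>"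
    using \<Gamma> by (auto simp: oriented_boundary_def)
  have zfr: "z \<notin> frontier D" using z D(1) by (auto simp: frontier_def interior_open)
  have im: "path_image \<gamma> \<subseteq> S - {z}" if "\<gamma> \<in> \<Gamma>" for \<gamma>
    using that fr D zfr by (auto simp: frontier_def)
  define q where "q w = (if w = z then deriv g z else (g w - g z) / (w - z))" for w
  have q: "q holomorphic_on S" unfolding q_def by (rule pole_lemma_open[OF g S])
  have "contour_integral \<gamma> (\<lambda>w. g w / (w - z)) =
      contour_integral \<gamma> q + 2 * pi * \<i> * g z * winding_number \<gamma> z" if ga: "\<gamma> \<in> \<Gamma>" for \<gamma>
  proof -
    have "(q has_contour_integral contour_integral \<gamma> q) \<gamma>"
      using contour_integrable_holomorphic_simple[OF q S val[OF ga]] im[OF ga]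
      by (intro has_contour_integral_integral) auto
    moreover have "((\<lambda>w. g z * (1 / (w - z))) has_contour_integral
        g z * (2 * pi * \<i> * winding_number \<gamma> z)) \<gamma>"
      using im[OF ga] val[OF ga]
      by (intro has_contour_integral_lmul has_contour_integral_winding_number) auto
    ultimately have "((\<lambda>w. q w + g z * (1 / (w - z))) has_contour_integral
        contour_integral \<gamma> q + g z * (2 * pi * \<i> * winding_number \<gamma> z)) \<gamma>"
      by (rule has_contour_integral_add)
    then have "((\<lambda>w. g w / (w - z)) has_contour_integral
        contour_integral \<gamma> q + g z * (2 * pi * \<i> * winding_number \<gamma> z)) \<gamma>"
      by (rule has_contour_integral_eq) (use im[OF ga] in \<open>auto simp: q_def diff_divide_distrib\<close>)
    then show ?thesis by (simp add: contour_integral_unique mult_ac)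
  qed
  then have "(\<Sum>\<gamma>\<in>\<Gamma>. contour_integral \<gamma> (\<lambda>w. g w / (w - z))) =
      (\<Sum>\<gamma>\<in>\<Gamma>. contour_integral \<gamma> q) + 2 * pi * \<i> * g z * (\<Sum>\<gamma>\<in>\<Gamma>. winding_number \<gamma> z)"
    by (simp add: sum.distrib sum_distrib_left)
  then show ?thesis
    using Cauchy_theorem_oriented_boundary[OF \<Gamma> D(2,3) S q]
      winding_number_sum_oriented_boundary[OF \<Gamma> D(2) zfr] z by simp
qed

section \<open>Functions with values in a space with a complex structure\<close>

text \<open>
  An endomorphism \<open>J\<close> with \<open>J \<circ> J = -1\<close> turns a real vector space into a complex one; this is its
  scalar multiplication. Left and right slice functions are treated together by taking for \<open>J\<close>
  the multiplication by an imaginary unit from the left or from the right.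
\<close>

definition complex_scale :: "('e \<Rightarrow> 'e) \<Rightarrow> complex \<Rightarrow> 'e \<Rightarrow> 'e::real_vector" where
  "complex_scale J w y = Re w *\<^sub>R y + Im w *\<^sub>R J y"

text \<open>
  For every basis vector \<open>b\<close> the map \<open>\<phi> b\<close> below is complex linear with respect to \<open>J\<close>, and its real
  part is the coordinate along \<open>b\<close>. Hence \<open>\<phi> b \<circ> G\<close> is an ordinary holomorphic function, and the
  coordinates of the asserted formula are the real parts of Cauchy's formulas for these functions.
  The factor \<open>-\<i>\<close> is the one in the line element \<open>ds (-j)\<close>; it changes the constant \<open>2 \<pi> \<i>\<close> to \<open>2 \<pi>\<close>.
\<close>

theorem Cauchy_formula_complex_structure:
  fixes J :: "'e::euclidean_space \<Rightarrow> 'e" and G :: "complex \<Rightarrow> 'e"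
  assumes J: "linear J" "\<And>y. J (J y) = - y"
    and \<Gamma>: "oriented_boundary D \<Gamma>" and D: "open D" "bounded D" "closure D \<subseteq> S"
    and S: "open S" and z: "z \<in> D"
    and G: "\<And>w. w \<in> S \<Longrightarrow> \<exists>d. (G has_derivative (\<lambda>h. complex_scale J h d)) (at w)"
  shows "\<exists>I. (\<forall>\<gamma>\<in>\<Gamma>. ((\<lambda>t. complex_scale J (vector_derivative \<gamma> (at t within {0..1}) * - \<i> / (\<gamma> t - z))
      (G (\<gamma> t))) has_integral I \<gamma>) {0..1}) \<and> sum I \<Gamma> = (2 * pi) *\<^sub>R G z"
proof -
  define \<phi> where "\<phi> b y = Complex (y \<bullet> b) (- (J y \<bullet> b))" for b y
  have \<phi>_scale: "\<phi> b (complex_scale J w y) = w * \<phi> b y" for b w y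
    by (simp add: \<phi>_def complex_scale_def complex_eq_iff linear_add[OF J(1)] linear_scale[OF J(1)]
        J(2) algebra_simps)
  have \<phi>_lin: "bounded_linear (\<phi> b)" for b
    by (rule linear_conv_bounded_linear[THEN iffD1], rule linearI)
      (simp_all add: \<phi>_def complex_eq_iff linear_add[OF J(1)] linear_scale[OF J(1)] algebra_simps)
  define g where "g b w = - \<i> * \<phi> b (G w)" for b w
  have hol: "g b holomorphic_on S" for b
    unfolding holomorphic_on_def
  proof
    fix w assume "w \<in> S"
    then obtain d where "(G has_derivative (\<lambda>h. complex_scale J h d)) (at w)" using G by blast
    then have "((\<lambda>w. \<phi> b (G w)) has_derivative (\<lambda>h. \<phi> b (complex_scale J h d))) (at w)"
      by (rule bounded_linear.has_derivative[OF \<phi>_lin])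
    then have "((\<lambda>w. \<phi> b (G w)) has_field_derivative \<phi> b d) (at w)"
      by (simp add: has_field_derivative_def \<phi>_scale mult.commute[of _ "\<phi> b d"])
    then have "(g b has_field_derivative - \<i> * \<phi> b d) (at w)"
      unfolding g_def by (rule DERIV_cmult)
    then show "g b field_differentiable at w within S"
      using field_differentiable_at_within field_differentiable_def by blast
  qed
  have fr: "frontier D = (\<Union>\<gamma>\<in>\<Gamma>. path_image \<gamma>)"
    and val: "\<And>\<gamma>. \<gamma> \<in> \<Gamma> \<Longrightarrow> valid_path \<gamma>"
    using \<Gamma> by (auto simp: oriented_boundary_def)
  have im: "path_image \<gamma> \<subseteq> S - {z}" if "\<gamma> \<in> \<Gamma>" for \<gamma>
    using that fr D z by (auto simp: frontier_def interior_open)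
  define c where "c b \<gamma> = contour_integral \<gamma> (\<lambda>w. g b w / (w - z))" for b \<gamma>
  have sumc: "(\<Sum>\<gamma>\<in>\<Gamma>. c b \<gamma>) = 2 * pi * \<phi> b (G z)" for b
  proof -
    have cancel: "x * \<i> * (- \<i> * y) = x * y" for x y :: complex
      by (simp add: complex_eq_iff)
    have "2 * pi * \<i> * g b z = 2 * pi * \<phi> b (G z)" unfolding g_def by (rule cancel)
    then show ?thesis
      unfolding c_def using Cauchy_formula_oriented_boundary[OF \<Gamma> D S hol z, of b] by metis
  qed
  define I where "I \<gamma> = (\<Sum>b\<in>Basis. Re (c b \<gamma>) *\<^sub>R b)" for \<gamma>
  have I_inner: "I \<gamma> \<bullet> b = Re (c b \<gamma>)" if "b \<in> Basis" for b \<gamma>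
    using that by (simp add: I_def inner_sum_left_Basis)
  have "((\<lambda>t. complex_scale J (vector_derivative \<gamma> (at t within {0..1}) * - \<i> / (\<gamma> t - z))
      (G (\<gamma> t))) has_integral I \<gamma>) {0..1}" if ga: "\<gamma> \<in> \<Gamma>" for \<gamma>
  proof (rule has_integral_componentwise)
    fix b :: 'e assume b: "b \<in> Basis"
    have "(\<lambda>w. g b w / (w - z)) contour_integrable_on \<gamma>"
    proof (rule contour_integrable_holomorphic_simple[OF _ _ val[OF ga] im[OF ga]])
      show "(\<lambda>w. g b w / (w - z)) holomorphic_on S - {z}"
        using hol[of b] by (intro holomorphic_intros) (auto intro: holomorphic_on_subset)
    qed (use S in auto)
    then have "((\<lambda>w. g b w / (w - z)) has_contour_integral c b \<gamma>) \<gamma>"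
      unfolding c_def by (rule has_contour_integral_integral)
    then have "((\<lambda>t. Re (g b (\<gamma> t) / (\<gamma> t - z) * vector_derivative \<gamma> (at t within {0..1})))
        has_integral Re (c b \<gamma>)) {0..1}"
      unfolding has_contour_integral_def
      by (drule_tac has_integral_linear[OF _ bounded_linear_Re]) (simp add: o_def)
    moreover have "Re (g b (\<gamma> t) / (\<gamma> t - z) * vector_derivative \<gamma> (at t within {0..1})) =
      complex_scale J (vector_derivative \<gamma> (at t within {0..1}) * - \<i> / (\<gamma> t - z)) (G (\<gamma> t)) \<bullet> b" for t
    proof -
      have inner_b: "complex_scale J w y \<bullet> b = Re (w * \<phi> b y)" for w y
        using arg_cong[OF \<phi>_scale[of b w y], of Re] by (simp add: \<phi>_def)
      show ?thesis unfolding inner_b g_def by (rule arg_cong[of _ _ Re]) simp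
    qed
    ultimately show "((\<lambda>t. complex_scale J (vector_derivative \<gamma> (at t within {0..1}) * - \<i> / (\<gamma> t - z))
      (G (\<gamma> t)) \<bullet> b) has_integral I \<gamma> \<bullet> b) {0..1}"
      using I_inner[OF b] by simp
  qed
  moreover have "sum I \<Gamma> = (2 * pi) *\<^sub>R G z"
  proof (rule euclidean_eqI)
    fix b :: 'e assume b: "b \<in> Basis"
    have "sum I \<Gamma> \<bullet> b = (\<Sum>\<gamma>\<in>\<Gamma>. Re (c b \<gamma>))"
      using I_inner[OF b] by (simp add: inner_sum_left)
    also have "\<dots> = Re (\<Sum>\<gamma>\<in>\<Gamma>. c b \<gamma>)" by simp
    also have "\<dots> = (2 * pi) *\<^sub>R G z \<bullet> b" unfolding sumc by (simp add: \<phi>_def)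
    finally show "sum I \<Gamma> \<bullet> b = (2 * pi) *\<^sub>R G z \<bullet> b" .
  qed
  ultimately show ?thesis by blast
qed

text \<open>
  Existence of one partial derivative and continuity of the other give the total derivative. The
  continuous one is taken along \<open>v\<close>, on a product neighbourhood \<open>A \<times> Y\<close>
  whose second factor is convex, so that the mean value theorem applies there.
\<close>

lemma class_C_Suc_has_derivative:
  assumes f: "class_C (Suc k) \<Omega> f" and \<Omega>: "open \<Omega>" "p \<in> \<Omega>"
  shows "(f has_derivative (\<lambda>h. fst h *\<^sub>R diff_u f p + snd h *\<^sub>R diff_v f p)) (at p)"
proof -
  obtain u v where p: "p = (u, v)" by (cases p)
  obtain A B where AB: "open A" "open B" "p \<in> A \<times> B" "A \<times> B \<subseteq> \<Omega>"
    using open_prod_elim[OF \<Omega>] by blast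
  then have "v \<in> B" by (simp add: p)
  then obtain e where e: "e > 0" "ball v e \<subseteq> B" using AB(2) open_contains_ball by blast
  define Y where "Y = ball v e"
  have sub: "A \<times> Y \<subseteq> \<Omega>" and uv: "u \<in> A" "v \<in> Y" using AB e by (auto simp: Y_def p)
  have du: "((\<lambda>t. f (t, snd q)) has_derivative (\<lambda>h. h *\<^sub>R diff_u f q)) (at (fst q))"
    and dv: "((\<lambda>t. f (fst q, t)) has_derivative (\<lambda>h. h *\<^sub>R diff_v f q)) (at (snd q))"
    if "q \<in> \<Omega>" for q
    using f that by (simp_all add: diff_u_def diff_v_def vector_derivative_works
        has_vector_derivative_def [symmetric])
  have cont: "continuous_on \<Omega> (diff_v f)" using f by (cases k) auto
  have "((\<lambda>(x, y). f (x, y)) has_derivative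
      (\<lambda>(tx, ty). tx *\<^sub>R diff_u f (u, v) + blinfun_scaleR_left (diff_v f (u, v)) ty))
      (at (u, v) within A \<times> Y)"
  proof (rule has_derivative_partialsI)
    show "((\<lambda>x. f (x, v)) has_derivative (\<lambda>t. t *\<^sub>R diff_u f (u, v))) (at u within A)"
      using du[of "(u, v)"] sub uv by (auto intro: has_derivative_at_withinI)
    show "((\<lambda>y. f (x, y)) has_derivative blinfun_apply (blinfun_scaleR_left (diff_v f (x, y)))) (at y within Y)"
      if "x \<in> A" "y \<in> Y" for x y
      using dv[of "(x, y)"] sub that by (auto intro: has_derivative_at_withinI)
    have "continuous (at (u, v) within A \<times> Y) (\<lambda>q. blinfun_scaleR_left (diff_v f q))"
      using continuous_on_subset[OF cont sub] uv
      by (intro bounded_linear.continuous[OF bounded_linear_blinfun_scaleR_left])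
        (auto simp: continuous_on_eq_continuous_within)
    then show "continuous (at (u, v) within A \<times> Y) (\<lambda>(x, y). blinfun_scaleR_left (diff_v f (x, y)))"
      by (simp add: case_prod_unfold)
  qed (use uv in \<open>auto simp: Y_def\<close>)
  moreover have "at (u, v) within A \<times> Y = at (u, v)"
    using AB uv by (intro at_within_open open_Times) (auto simp: Y_def)
  ultimately show ?thesis by (simp add: p case_prod_unfold)
qed

text \<open>
  The Cauchy-Riemann equation \<open>G\<^sub>u + J G\<^sub>v = 0\<close> says that \<open>G\<^sub>v = J G\<^sub>u\<close>, that is, that the total
  derivative of \<open>G = F0 + J F1\<close> is the complex multiple \<open>h \<mapsto> h G\<^sub>u\<close>.
\<close>

lemma stem_Cauchy_Riemann_has_derivative:
  fixes J :: "'e::euclidean_space \<Rightarrow> 'e"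
  assumes J: "linear J" "\<And>y. J (J y) = - y"
    and F: "class_C (Suc k) \<Omega> F0" "class_C (Suc k) \<Omega> F1"
    and \<Omega>: "open \<Omega>" "(Re w, Im w) \<in> \<Omega>"
    and CR: "diff_u (\<lambda>p. F0 p + J (F1 p)) (Re w, Im w)
       + J (diff_v (\<lambda>p. F0 p + J (F1 p)) (Re w, Im w)) = 0"
  shows "\<exists>d. ((\<lambda>w. F0 (Re w, Im w) + J (F1 (Re w, Im w))) has_derivative
    (\<lambda>h. complex_scale J h d)) (at w)"
proof -
  let ?p = "(Re w, Im w)"
  let ?G = "\<lambda>p. F0 p + J (F1 p)"
  have bJ: "bounded_linear J" using J(1) by (simp add: linear_conv_bounded_linear)
  define a where "a = diff_u F0 ?p + J (diff_u F1 ?p)"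
  define b where "b = diff_v F0 ?p + J (diff_v F1 ?p)"
  have D: "(?G has_derivative (\<lambda>h. fst h *\<^sub>R a + snd h *\<^sub>R b)) (at ?p)"
    using has_derivative_add[OF class_C_Suc_has_derivative[OF F(1) \<Omega>]
       bounded_linear.has_derivative[OF bJ class_C_Suc_has_derivative[OF F(2) \<Omega>]]]
    by (simp add: a_def b_def linear_add[OF J(1)] linear_scale[OF J(1)] algebra_simps)
  have "((\<lambda>t. ?G (t, Im w)) has_derivative (\<lambda>h. h *\<^sub>R a)) (at (Re w))"
  proof -
    have "((\<lambda>t. (t, Im w)) has_derivative (\<lambda>h. (h, 0))) (at (Re w))"
      by (auto intro!: derivative_eq_intros)
    from has_derivative_compose[OF this D] show ?thesis by simp
  qed
  then have a: "diff_u ?G ?p = a"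
    by (simp add: diff_u_def has_vector_derivative_def[symmetric] vector_derivative_at)
  have "((\<lambda>t. ?G (Re w, t)) has_derivative (\<lambda>h. h *\<^sub>R b)) (at (Im w))"
  proof -
    have "((\<lambda>t. (Re w, t)) has_derivative (\<lambda>h. (0, h))) (at (Im w))"
      by (auto intro!: derivative_eq_intros)
    from has_derivative_compose[OF this D] show ?thesis by simp
  qed
  then have b: "diff_v ?G ?p = b"
    by (simp add: diff_v_def has_vector_derivative_def[symmetric] vector_derivative_at)
  have "a = - J b" using CR unfolding a b by (simp add: eq_neg_iff_add_eq_0)
  then have "J a = b" by (simp add: J linear_neg[OF J(1)])
  moreover have "((\<lambda>w. ?G (Re w, Im w)) has_derivative (\<lambda>h. Re h *\<^sub>R a + Im h *\<^sub>R b)) (at w)"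
  proof -
    have "((\<lambda>w. (Re w, Im w)) has_derivative (\<lambda>h. (Re h, Im h))) (at w)"
      by (auto intro!: derivative_eq_intros)
    from has_derivative_compose[OF this D] show ?thesis by simp
  qed
  ultimately show ?thesis by (auto simp: complex_scale_def)
qed

section \<open>Slices of the Clifford algebra and the Cauchy kernels\<close>

text \<open>
  The copy of the complex plane in the algebra with \<open>\<i>\<close> sent to \<open>j\<close>. If \<open>j * j = -1\<close>, it is a
  ring homomorphism, so that computations in one slice can be done with complex numbers.
\<close>

definition slice_embed :: "'n::{finite,linorder} clifford \<Rightarrow> complex \<Rightarrow> 'n clifford" where
  "slice_embed j w = slice_pt j (Re w) (Im w)"

lemma slice_embed_add: "slice_embed j (v + w) = slice_embed j v + slice_embed j w"
  and slice_embed_diff: "slice_embed j (v - w) = slice_embed j v - slice_embed j w"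
  and slice_embed_minus: "slice_embed j (- w) = - slice_embed j w"
  and slice_embed_of_real: "slice_embed j (of_real a) = of_real a"
  and slice_embed_i: "slice_embed j \<i> = j"
  by (simp_all add: slice_embed_def slice_pt_def algebra_simps)

lemma slice_embed_mult: "slice_embed j (v * w) = slice_embed j v * slice_embed j w" if "j * j = - 1"
  using that by (simp add: slice_embed_def slice_pt_def of_real_def algebra_simps)

lemma imag_sphere_uminus: "j \<in> imag_sphere \<Longrightarrow> - j \<in> imag_sphere"
  unfolding imag_sphere_def
proof clarsimp
  fix c :: "'a \<Rightarrow> real" assume "(\<Sum>l\<in>UNIV. (c l)\<^sup>2) = 1"
  then show "\<exists>d. - (\<Sum>l\<in>UNIV. c l *\<^sub>R gen l) = (\<Sum>l\<in>UNIV. d l *\<^sub>R gen l) \<and> (\<Sum>l\<in>UNIV. (d l)\<^sup>2) = 1"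
    by (intro exI[of _ "\<lambda>l. - c l"]) (simp add: sum_negf)
qed

lemma imag_sphere_square:
  assumes "j \<in> imag_sphere" shows "j * j = - 1"
proof -
  obtain c where j: "j = (\<Sum>l\<in>UNIV. c l *\<^sub>R gen l)" and c: "(\<Sum>l\<in>UNIV. (c l)\<^sup>2) = 1"
    using assms by (auto simp: imag_sphere_def)
  \<comment> \<open>Averaging over the two orders of multiplication leaves only the anticommutators of generators.\<close>
  have jj: "j * j = (\<Sum>l\<in>UNIV. \<Sum>m\<in>UNIV. (c l * c m) *\<^sub>R (gen l * gen m))"
    by (simp add: j sum_product mult.commute)
  also have "\<dots> = (\<Sum>l\<in>UNIV. \<Sum>m\<in>UNIV. (c l * c m) *\<^sub>R (gen m * gen l))"
    by (subst sum.swap) (intro sum.cong refl, simp add: mult.commute)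
  finally have "2 *\<^sub>R (j * j) = (\<Sum>l\<in>UNIV. \<Sum>m\<in>UNIV. (c l * c m) *\<^sub>R (gen l * gen m + gen m * gen l))"
    using jj by (simp add: scaleR_2 scaleR_add_right sum.distrib)
  also have "\<dots> = (\<Sum>l\<in>UNIV. \<Sum>m\<in>UNIV. if m = l then (c l * c l) *\<^sub>R (- 2) else 0)"
  proof (intro sum.cong refl)
    fix l m :: 'a
    show "(c l * c m) *\<^sub>R (gen l * gen m + gen m * gen l) = (if m = l then (c l * c l) *\<^sub>R (- 2) else 0)"
      by (cases "m = l") (simp_all add: gen_square gen_anticommute)
  qed
  also have "\<dots> = (\<Sum>l\<in>UNIV. (c l)\<^sup>2) *\<^sub>R (- 2)"
    by (simp add: power2_eq_square scaleR_left.sum sum_negf)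
  also have "\<dots> = 2 *\<^sub>R (- 1 :: 'a clifford)" using c by (simp add: scaleR_conv_of_real)
  finally show ?thesis by (simp only: scaleR_cancel_left) simp
qed

lemma coeff_one: "coeff 1 A = (if A = {} then 1 else 0)"
  by (simp add: one_clifford_def)

lemma coeff_generator_sum:
  "coeff (\<Sum>l\<in>UNIV. c l *\<^sub>R gen l) A = (\<Sum>l\<in>UNIV. if A = {l} then c l else 0)"
  by (auto simp: coeff_sum gen_def blade_def intro: sum.cong)

lemma norm_square_generator_sum:
  "(norm (\<Sum>l\<in>UNIV. c l *\<^sub>R gen l :: 'n::{finite,linorder} clifford))\<^sup>2 = (\<Sum>l\<in>UNIV. (c l)\<^sup>2)"
proof -
  have gb: "(gen l :: 'n clifford) \<in> Basis" for l by (simp add: gen_def Basis_clifford_def)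
  have gi: "gen l \<bullet> (gen m :: 'n clifford) = (if l = m then 1 else 0)" for l m
  proof -
    have "gen l = (gen m :: 'n clifford) \<Longrightarrow> l = m"
      by (drule arg_cong[of _ _ "\<lambda>y. coeff y {l}"]) (simp add: gen_def blade_def split: if_splits)
    then show ?thesis using inner_Basis[OF gb gb, of l m] by auto
  qed
  show ?thesis
    unfolding power2_norm_eq_inner
    by (simp add: inner_sum_left inner_sum_right gi power2_eq_square
        if_distrib[of "(*) _"] cong: if_cong)
qed

lemma
  assumes "j \<in> imag_sphere"
  shows re_part_slice_embed: "re_part (slice_embed j w) = Re w"
    and vec_part_slice_embed: "vec_part (slice_embed j w) = Im w *\<^sub>R j"
    and pconj_slice_embed: "pconj (slice_embed j w) = slice_embed j (cnj w)"
    and norm_slice_embed: "norm (slice_embed j w) = cmod w"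
    and slice_embed_paravector: "slice_embed j w \<in> paravectors"
    and norm_imag_sphere: "norm j = 1"
proof -
  obtain c where j: "j = (\<Sum>l\<in>UNIV. c l *\<^sub>R gen l)" and c: "(\<Sum>l\<in>UNIV. (c l)\<^sup>2) = 1"
    using assms by (auto simp: imag_sphere_def)
  have j0: "coeff j {} = 0" and jl: "coeff j {l} = c l" for l
    by (simp_all add: j coeff_generator_sum)
  show re: "re_part (slice_embed j w) = Re w"
    by (simp add: re_part_def slice_embed_def slice_pt_def of_real_def coeff_one j0)
  show vec: "vec_part (slice_embed j w) = Im w *\<^sub>R j"
    by (simp add: vec_part_def slice_embed_def slice_pt_def of_real_def coeff_one jl)
      (simp add: j scaleR_sum_right)
  show "pconj (slice_embed j w) = slice_embed j (cnj w)"
    by (simp add: pconj_def re vec) (simp add: slice_embed_def slice_pt_def)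
  have nj: "(norm j)\<^sup>2 = 1" using c by (simp add: j norm_square_generator_sum)
  then show "norm j = 1" using norm_ge_zero[of j] by (simp add: power2_eq_1_iff)
  have "(1 :: 'a clifford) \<bullet> j = 0"
    by (simp add: inner_clifford_def coeff_one j0 if_distrib[of "\<lambda>x. x * _"] cong: if_cong)
  moreover have "(1 :: 'a clifford) \<bullet> 1 = 1"
    by (simp add: inner_clifford_def coeff_one if_distrib[of "\<lambda>x. x * _"] cong: if_cong)
  ultimately have "(norm (slice_embed j w))\<^sup>2 = (Re w)\<^sup>2 + (Im w)\<^sup>2"
    using nj unfolding power2_norm_eq_inner
    by (simp add: power2_eq_square slice_embed_def slice_pt_def of_real_def inner_add_left inner_add_right
        inner_commute[of j 1])
  then show "norm (slice_embed j w) = cmod w" by (simp add: cmod_def real_sqrt_unique)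
  show "slice_embed j w \<in> paravectors"
    unfolding paravectors_def slice_embed_def slice_pt_def
    by (intro CollectI exI[of _ "Re w"] exI[of _ "\<lambda>l. Im w * c l"]) (simp add: j scaleR_sum_right)
qed

lemma imag_sphere_nonempty: "imag_sphere \<noteq> ({} :: 'n::{finite,linorder} clifford set)"
proof -
  obtain m :: 'n where True by simp
  have "(\<Sum>l\<in>UNIV. (if l = m then 1 else 0) *\<^sub>R gen l) \<in> (imag_sphere :: 'n clifford set)"
    unfolding imag_sphere_def
    by (intro CollectI exI[of _ "\<lambda>l. if l = m then 1 else 0"]) (simp add: if_distrib[of "\<lambda>x. x^2"] cong: if_cong)
  then show ?thesis by blast
qed

lemma paravector_eq_slice_embed:
  assumes x: "x \<in> (paravectors :: 'n::{finite,linorder} clifford set)"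
  obtains i where "i \<in> imag_sphere" "x = slice_embed i (Complex (re_part x) (norm (vec_part x)))"
proof -
  obtain a c where xac: "x = of_real a + (\<Sum>l\<in>UNIV. c l *\<^sub>R gen l)"
    using x by (auto simp: paravectors_def)
  have re: "re_part x = a"
    by (simp add: xac re_part_def of_real_def coeff_one coeff_generator_sum)
  have vec: "vec_part x = (\<Sum>l\<in>UNIV. c l *\<^sub>R gen l)"
    by (simp add: xac vec_part_def of_real_def coeff_one coeff_generator_sum)
  define r where "r = norm (vec_part x)"
  show thesis
  proof (cases "r = 0")
    case True
    obtain i :: "'n clifford" where "i \<in> imag_sphere" using imag_sphere_nonempty by blast
    moreover have "vec_part x = 0" using True by (simp add: r_def)
    ultimately show thesis using that[of i] True vec re xac
      by (simp add: r_def[symmetric] slice_embed_def slice_pt_def)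
  next
    case False
    have r2: "r\<^sup>2 = (\<Sum>l\<in>UNIV. (c l)\<^sup>2)" by (simp add: r_def vec norm_square_generator_sum)
    define i where "i = (\<Sum>l\<in>UNIV. (c l / r) *\<^sub>R gen l :: 'n clifford)"
    have "(\<Sum>l\<in>UNIV. (c l / r)\<^sup>2) = 1"
      using False by (simp add: power_divide sum_divide_distrib[symmetric] r2[symmetric])
    then have "i \<in> imag_sphere" by (auto simp: i_def imag_sphere_def)
    moreover have ri: "r *\<^sub>R i = vec_part x" using False by (simp add: i_def vec scaleR_sum_right)
    moreover have "x = slice_embed i (Complex (re_part x) r)"
      unfolding slice_embed_def slice_pt_def complex.sel re ri vec by (rule xac)
    ultimately show thesis using that[of i] by (simp add: r_def)
  qed
qed

text \<open>
  The sphere \<open>ax_sphere\<close> of a point is parametrized with the nonnegative imaginary part \<open>\<bar>Im w\<bar>\<close>;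
  for \<open>Im w < 0\<close> the imaginary unit \<open>- j\<close> has to be used.
\<close>

lemma slice_embed_mem_axially_symmetric:
  assumes U: "axially_symmetric U" and ij: "i \<in> imag_sphere" "j \<in> imag_sphere"
    and x: "slice_embed i w \<in> U"
  shows "slice_embed j w \<in> U"
proof -
  have sub: "ax_sphere (slice_embed i w) \<subseteq> U" using U x by (simp add: axially_symmetric_def)
  have ax: "slice_pt k (Re w) \<bar>Im w\<bar> \<in> U" if "k \<in> imag_sphere" for k
  proof -
    have "norm (vec_part (slice_embed i w)) = \<bar>Im w\<bar>"
      by (simp add: vec_part_slice_embed[OF ij(1)] norm_imag_sphere[OF ij(1)])
    then have "slice_pt k (Re w) \<bar>Im w\<bar> \<in> ax_sphere (slice_embed i w)"
      unfolding ax_sphere_def re_part_slice_embed[OF ij(1)] using that by auto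
    then show ?thesis using sub by blast
  qed
  show ?thesis
  proof (cases "Im w \<ge> 0")
    case True then show ?thesis using ax[OF ij(2)] by (simp add: slice_embed_def)
  next
    case False then show ?thesis using ax[OF imag_sphere_uminus[OF ij(2)]] by (simp add: slice_embed_def slice_pt_def)
  qed
qed

lemma mem_slice_section_iff: "w \<in> slice_section j U \<longleftrightarrow> slice_embed j w \<in> U"
  by (simp add: slice_section_def slice_embed_def)

lemma mem_stem_domain_iff:
  assumes "axially_symmetric U" "j \<in> imag_sphere"
  shows "(Re w, Im w) \<in> stem_domain U \<longleftrightarrow> w \<in> slice_section j U"
  using assms slice_embed_mem_axially_symmetric[OF assms(1), of j _ w]
  by (auto simp: stem_domain_def mem_slice_section_iff slice_embed_def)

text \<open>
  The conjugate \<open>cnj z\<close> belongs to the section because \<open>x\<close> can also be written with the imaginary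
  unit \<open>- i\<close>. Thus both poles of the kernel lie in the domain bounded by the curves.
\<close>

lemma axially_symmetric_point:
  assumes U: "axially_symmetric U" and j: "j \<in> imag_sphere" and x: "x \<in> U"
  obtains i z where "i \<in> imag_sphere" "x = slice_embed i z"
    "z \<in> slice_section j U" "cnj z \<in> slice_section j U"
proof -
  have "x \<in> paravectors" using U x by (auto simp: axially_symmetric_def)
  then obtain i z where i: "i \<in> imag_sphere" and z: "x = slice_embed i z"
    using paravector_eq_slice_embed by metis
  have z': "x = slice_embed (- i) (cnj z)" by (simp add: z slice_embed_def slice_pt_def)
  show thesis
  proof (rule that[OF i z])
    show "z \<in> slice_section j U" "cnj z \<in> slice_section j U"
      using slice_embed_mem_axially_symmetric[OF U i j] slice_embed_mem_axially_symmetric[OF U imag_sphere_uminus[OF i] j]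
        x z z' by (auto simp: mem_slice_section_iff)
  qed
qed

lemma linear_slice_embed: "linear (slice_embed j)"
  by (rule linearI) (simp_all add: slice_embed_def slice_pt_def of_real_def algebra_simps)

lemma continuous_on_slice_embed: "continuous_on X (slice_embed j)"
  using linear_slice_embed linear_conv_bounded_linear linear_continuous_on by blast

lemma open_slice_section:
  assumes U: "axially_symmetric_open U" and j: "j \<in> imag_sphere"
  shows "open (slice_section j U)"
proof -
  obtain T where T: "open T" "U = paravectors \<inter> T"
    using U by (auto simp: axially_symmetric_open_def openin_open)
  have "slice_section j U = slice_embed j -` T"
    by (auto simp: mem_slice_section_iff T(2) slice_embed_paravector[OF j])
  then show ?thesis using T(1) continuous_on_slice_embed[of UNIV j] by (simp add: open_vimage)
qed

lemma bounded_slice_section: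
  assumes "bounded U" "j \<in> imag_sphere" shows "bounded (slice_section j U)"
  using assms unfolding bounded_iff by (metis mem_slice_section_iff norm_slice_embed)

lemma closure_slice_section:
  assumes "closure U \<subseteq> V" shows "closure (slice_section j U) \<subseteq> slice_section j V"
proof
  fix w assume "w \<in> closure (slice_section j U)"
  then have "slice_embed j w \<in> closure (slice_embed j ` slice_section j U)"
    using image_closure_subset[OF continuous_on_slice_embed closed_closure closure_subset] by blast
  also have "\<dots> \<subseteq> closure U" by (rule closure_mono) (auto simp: mem_slice_section_iff)
  finally show "w \<in> slice_section j V" using assms by (auto simp: mem_slice_section_iff)
qed

lemma cl_inverse_eq: "cl_inverse a = b" if "a * b = 1" "b * a = 1"
  unfolding cl_inverse_def
proof (rule the_equality)
  fix c assume c: "a * c = 1 \<and> c * a = 1"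
  have "c = (b * a) * c" using that by simp
  also have "\<dots> = b" using c by (simp add: mult.assoc)
  finally show "c = b" .
qed (use that in simp)

text \<open>
  In the slice of \<open>x = u + i v\<close> the denominator of the Cauchy kernels is the complex polynomial
  \<open>(z - w) (z - cnj w)\<close>, so its inverse can be computed there, even though \<open>s = slice_embed j w\<close>
  may lie in another slice.
\<close>

lemma kernel_denominator_inverse:
  assumes i: "i \<in> imag_sphere" and j: "j \<in> imag_sphere" and z: "w \<noteq> z" "w \<noteq> cnj z"
  shows "cl_inverse ((slice_embed i z)\<^sup>2 - (2 * re_part (slice_embed j w)) *\<^sub>R slice_embed i z
      + of_real ((norm (slice_embed j w))\<^sup>2)) = slice_embed i (1 / ((z - w) * (z - cnj w)))"
proof -
  note ii = imag_sphere_square[OF i]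
  have "(slice_embed i z)\<^sup>2 - (2 * re_part (slice_embed j w)) *\<^sub>R slice_embed i z + of_real ((norm (slice_embed j w))\<^sup>2)
      = slice_embed i (z\<^sup>2 - of_real (2 * Re w) * z + of_real ((cmod w)\<^sup>2))"
    unfolding re_part_slice_embed[OF j] norm_slice_embed[OF j] slice_embed_add slice_embed_diff slice_embed_of_real
      slice_embed_mult[OF ii] power2_eq_square
    by (simp add: scaleR_conv_of_real)
  also have "z\<^sup>2 - of_real (2 * Re w) * z + of_real ((cmod w)\<^sup>2) = (z - w) * (z - cnj w)"
    unfolding cmod_power2 by (simp add: complex_eq_iff power2_eq_square algebra_simps)
  finally have eq: "(slice_embed i z)\<^sup>2 - (2 * re_part (slice_embed j w)) *\<^sub>R slice_embed i z
      + of_real ((norm (slice_embed j w))\<^sup>2) = slice_embed i ((z - w) * (z - cnj w))" .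
  have nz: "(z - w) * (z - cnj w) \<noteq> 0" using z by (auto simp: complex_cnj_cnj)
  show ?thesis unfolding eq
    by (rule cl_inverse_eq; subst slice_embed_mult[OF ii, symmetric]; use nz slice_embed_of_real[of i 1] in simp)
qed

text \<open>
  The representation formula for the kernel: it combines the complex Cauchy kernels at \<open>z\<close> and at \<open>cnj z\<close>
  in the slice of \<open>s\<close> with the same coefficients as a left slice function at \<open>x\<close> combines its values
  at \<open>z\<close> and \<open>cnj z\<close>. The proof moves everything to the slice of \<open>s\<close> by means of the relations
  \<open>i (1 - i j) = (1 - i j) j\<close> and \<open>i (1 + i j) = - (1 + i j) j\<close>, the facts \<open>P\<close> and \<open>Q\<close>, which
  intertwine the two slices linearly and antilinearly.
\<close>

lemma S_L_eq_complex_kernels: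
  assumes i: "i \<in> imag_sphere" and j: "j \<in> imag_sphere" and z: "w \<noteq> z" "w \<noteq> cnj z"
  shows "S_L (slice_embed j w) (slice_embed i z) =
    (1 / 2) *\<^sub>R ((1 - i * j) * slice_embed j (1 / (w - z)) + (1 + i * j) * slice_embed j (1 / (w - cnj z)))" (is "?S = _ *\<^sub>R ?T")
proof -
  note ii = imag_sphere_square[OF i] and jj = imag_sphere_square[OF j]
  have P: "slice_embed i a * (1 - i * j) = (1 - i * j) * slice_embed j a" for a
    using ii jj by (simp add: slice_embed_def slice_pt_def of_real_def algebra_simps)
      (simp add: mult.assoc[symmetric])
  have Q: "slice_embed i a * (1 + i * j) = (1 + i * j) * slice_embed j (cnj a)" for a
    using ii jj by (simp add: slice_embed_def slice_pt_def of_real_def algebra_simps)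
      (simp add: mult.assoc[symmetric])
  have PP: "slice_embed i a * ((1 - i * j) * slice_embed j b) = (1 - i * j) * slice_embed j (a * b)" for a b
    by (simp only: P slice_embed_mult[OF jj] mult.assoc[symmetric])
  have QQ: "slice_embed i a * ((1 + i * j) * slice_embed j b) = (1 + i * j) * slice_embed j (cnj a * b)" for a b
    by (simp only: Q slice_embed_mult[OF jj] mult.assoc[symmetric])
  let ?q = "1 / ((z - w) * (z - cnj w))"
  have nz: "z - w \<noteq> 0" "z - cnj w \<noteq> 0" "cnj z - w \<noteq> 0" "cnj z - cnj w \<noteq> 0" using z by auto
  have "2 *\<^sub>R (slice_embed i z - slice_embed j (cnj w)) =
     (1 - i * j) * slice_embed j (z - cnj w) + (1 + i * j) * slice_embed j (cnj z - cnj w)"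
    using P[of z] Q[of z] by (simp add: slice_embed_diff algebra_simps scaleR_2)
  then have "2 *\<^sub>R S_L (slice_embed j w) (slice_embed i z) = - (slice_embed i ?q *
     ((1 - i * j) * slice_embed j (z - cnj w) + (1 + i * j) * slice_embed j (cnj z - cnj w)))"
    unfolding S_L_def kernel_denominator_inverse[OF assms] pconj_slice_embed[OF j]
    by (metis mult_scaleR_right scaleR_minus_right)
  also have "\<dots> = (1 - i * j) * slice_embed j (- (?q * (z - cnj w)))
      + (1 + i * j) * slice_embed j (- (cnj ?q * (cnj z - cnj w)))"
    by (simp only: distrib_left PP QQ slice_embed_minus mult_minus_right minus_add_distrib)
  also have "- (?q * (z - cnj w)) = 1 / (w - z)"
    using nz by (simp add: minus_divide_right)
  also have "- (cnj ?q * (cnj z - cnj w)) = 1 / (w - cnj z)"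
    using nz by (simp add: minus_divide_right)
  finally have "2 *\<^sub>R ?S = ?T" .
  from this[symmetric] show ?thesis by simp
qed

text \<open>
  The mirror image, with the intertwining relations \<open>(1 - j i) i = j (1 - j i)\<close> and
  \<open>(1 + j i) i = - j (1 + j i)\<close>.
\<close>

lemma S_R_eq_complex_kernels:
  assumes i: "i \<in> imag_sphere" and j: "j \<in> imag_sphere" and z: "w \<noteq> z" "w \<noteq> cnj z"
  shows "S_R (slice_embed j w) (slice_embed i z) =
    (1 / 2) *\<^sub>R (slice_embed j (1 / (w - z)) * (1 - j * i) + slice_embed j (1 / (w - cnj z)) * (1 + j * i))" (is "?S = _ *\<^sub>R ?T")
proof -
  note ii = imag_sphere_square[OF i] and jj = imag_sphere_square[OF j]
  have P: "(1 - j * i) * slice_embed i a = slice_embed j a * (1 - j * i)" for a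
    using ii jj by (simp add: slice_embed_def slice_pt_def of_real_def algebra_simps)
      (simp add: mult.assoc[symmetric])
  have Q: "(1 + j * i) * slice_embed i a = slice_embed j (cnj a) * (1 + j * i)" for a
    using ii jj by (simp add: slice_embed_def slice_pt_def of_real_def algebra_simps)
      (simp add: mult.assoc[symmetric])
  have PP: "(slice_embed j b * (1 - j * i)) * slice_embed i a = slice_embed j (b * a) * (1 - j * i)" for a b
    by (simp only: P slice_embed_mult[OF jj] mult.assoc)
  have QQ: "(slice_embed j b * (1 + j * i)) * slice_embed i a = slice_embed j (b * cnj a) * (1 + j * i)" for a b
    by (simp only: Q slice_embed_mult[OF jj] mult.assoc)
  let ?q = "1 / ((z - w) * (z - cnj w))"
  have nz: "z - w \<noteq> 0" "z - cnj w \<noteq> 0" "cnj z - w \<noteq> 0" "cnj z - cnj w \<noteq> 0" using z by auto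
  have "2 *\<^sub>R (slice_embed i z - slice_embed j (cnj w)) =
     slice_embed j (z - cnj w) * (1 - j * i) + slice_embed j (cnj z - cnj w) * (1 + j * i)"
    using P[of z] Q[of z] by (simp add: slice_embed_diff algebra_simps scaleR_2)
  then have "2 *\<^sub>R S_R (slice_embed j w) (slice_embed i z) = - ((slice_embed j (z - cnj w) * (1 - j * i)
      + slice_embed j (cnj z - cnj w) * (1 + j * i)) * slice_embed i ?q)"
    unfolding S_R_def kernel_denominator_inverse[OF assms] pconj_slice_embed[OF j]
    by (metis mult_scaleR_left scaleR_minus_right)
  also have "\<dots> = slice_embed j (- ((z - cnj w) * ?q)) * (1 - j * i)
      + slice_embed j (- ((cnj z - cnj w) * cnj ?q)) * (1 + j * i)"
    by (simp only: distrib_right PP QQ slice_embed_minus mult_minus_left minus_add_distrib)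
  also have "- ((z - cnj w) * ?q) = 1 / (w - z)"
    using nz by (simp add: minus_divide_right)
  also have "- ((cnj z - cnj w) * cnj ?q) = 1 / (w - cnj z)"
    using nz by (simp add: minus_divide_right)
  finally have "2 *\<^sub>R ?S = ?T" .
  from this[symmetric] show ?thesis by simp
qed

section \<open>Cauchy's formula for slice functions\<close>

lemma open_stem_domain:
  fixes V :: "'n::{finite,linorder} clifford set"
  assumes V: "axially_symmetric_open V"
  shows "open (stem_domain V)"
proof -
  obtain j :: "'n clifford" where j: "j \<in> imag_sphere" using imag_sphere_nonempty by blast
  have "stem_domain V = (\<lambda>p. Complex (fst p) (snd p)) -` slice_section j V"
    using mem_stem_domain_iff[of V j "Complex (fst p) (snd p)" for p] V j
    by (auto simp: axially_symmetric_open_def)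
  moreover have "continuous_on UNIV (\<lambda>p. Complex (fst p) (snd p))"
    by (simp add: Complex_eq) (intro continuous_intros)
  ultimately show ?thesis using open_slice_section[OF V j] by (simp add: open_vimage)
qed

lemma oriented_boundary_in_frontier:
  assumes \<Gamma>: "oriented_boundary D \<Gamma>" and "\<gamma> \<in> \<Gamma>" and t: "t \<in> {0..1}"
  shows "\<gamma> t \<in> frontier D"
proof -
  have "\<gamma> t \<in> path_image \<gamma>" using t by (simp add: path_image_def)
  then show ?thesis using assms unfolding oriented_boundary_def by blast
qed

text \<open>
  Cauchy's formula in the slice of \<open>j\<close>, for points of this slice only. The function \<open>J\<close> stands for
  the multiplication by \<open>j\<close> from the left or from the right.
\<close>

lemma slice_section_Cauchy_formula:
  fixes J :: "'n::{finite,linorder} clifford \<Rightarrow> 'n clifford"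
  assumes U: "axially_symmetric_open U" "bounded U"
    and V: "axially_symmetric_open V" "closure U \<subseteq> V"
    and j: "j \<in> imag_sphere" and \<Gamma>: "oriented_boundary (slice_section j U) \<Gamma>"
    and J: "linear J" "\<And>y. J (J y) = - y"
    and F: "class_C 1 (stem_domain V) F0" "class_C 1 (stem_domain V) F1"
    and f: "\<And>u v. (u, v) \<in> stem_domain V \<Longrightarrow> f (slice_pt j u v) = F0 (u, v) + J (F1 (u, v))"
    and CR: "\<And>p. p \<in> stem_domain V \<Longrightarrow> diff_u (\<lambda>p. F0 p + J (F1 p)) p
       + J (diff_v (\<lambda>p. F0 p + J (F1 p)) p) = 0"
    and z: "z \<in> slice_section j U"
  shows "\<exists>I. (\<forall>\<gamma>\<in>\<Gamma>. ((\<lambda>t. complex_scale J (vector_derivative \<gamma> (at t within {0..1}) * - \<i> / (\<gamma> t - z))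
      (f (slice_path j \<gamma> t))) has_integral I \<gamma>) {0..1}) \<and> sum I \<Gamma> = (2 * pi) *\<^sub>R f (slice_embed j z)"
proof -
  let ?G = "\<lambda>w. F0 (Re w, Im w) + J (F1 (Re w, Im w))"
  have dom: "(Re w, Im w) \<in> stem_domain V \<longleftrightarrow> w \<in> slice_section j V" for w
    using mem_stem_domain_iff[of V j] V j by (simp add: axially_symmetric_open_def)
  have fG: "f (slice_embed j w) = ?G w" if "w \<in> slice_section j V" for w
    using f[of "Re w" "Im w"] dom that by (simp add: slice_embed_def)
  have clo: "closure (slice_section j U) \<subseteq> slice_section j V"
    by (rule closure_slice_section[OF V(2)])
  have "\<exists>I. (\<forall>\<gamma>\<in>\<Gamma>. ((\<lambda>t. complex_scale J (vector_derivative \<gamma> (at t within {0..1}) * - \<i> / (\<gamma> t - z))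
      (?G (\<gamma> t))) has_integral I \<gamma>) {0..1}) \<and> sum I \<Gamma> = (2 * pi) *\<^sub>R ?G z"
  proof (rule Cauchy_formula_complex_structure[OF J \<Gamma> open_slice_section[OF U(1) j]
        bounded_slice_section[OF U(2) j] clo open_slice_section[OF V(1) j] z])
    fix w assume "w \<in> slice_section j V"
    then show "\<exists>d. (?G has_derivative (\<lambda>h. complex_scale J h d)) (at w)"
      using F CR dom open_stem_domain[OF V(1)]
      by (intro stem_Cauchy_Riemann_has_derivative[OF J, of 0 "stem_domain V"]) auto
  qed
  then obtain I where I: "\<And>\<gamma>. \<gamma> \<in> \<Gamma> \<Longrightarrow> ((\<lambda>t. complex_scale J
      (vector_derivative \<gamma> (at t within {0..1}) * - \<i> / (\<gamma> t - z)) (?G (\<gamma> t))) has_integral I \<gamma>) {0..1}"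
    and sumI: "sum I \<Gamma> = (2 * pi) *\<^sub>R ?G z" by blast
  have "((\<lambda>t. complex_scale J (vector_derivative \<gamma> (at t within {0..1}) * - \<i> / (\<gamma> t - z))
      (f (slice_path j \<gamma> t))) has_integral I \<gamma>) {0..1}" if g: "\<gamma> \<in> \<Gamma>" for \<gamma>
  proof (rule has_integral_eq[OF _ I[OF g]])
    fix t :: real assume "t \<in> {0..1}"
    then have "\<gamma> t \<in> slice_section j V"
      using oriented_boundary_in_frontier[OF \<Gamma> g] clo by (auto simp: frontier_def)
    then have "?G (\<gamma> t) = f (slice_path j \<gamma> t)"
      using fG by (simp add: slice_path_def slice_embed_def)
    then show "complex_scale J (vector_derivative \<gamma> (at t within {0..1}) * - \<i> / (\<gamma> t - z)) (?G (\<gamma> t)) =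
      complex_scale J (vector_derivative \<gamma> (at t within {0..1}) * - \<i> / (\<gamma> t - z)) (f (slice_path j \<gamma> t))"
      by simp
  qed
  moreover have "z \<in> slice_section j V" using z clo closure_subset by blast
  then have "sum I \<Gamma> = (2 * pi) *\<^sub>R f (slice_embed j z)" using sumI fG by simp
  ultimately show ?thesis by blast
qed

text \<open>
  The line element \<open>ds\<close> is the derivative of the curve in the algebra, and the complex integrals
  use the derivative of the curve in the plane. The two correspond wherever the curve is
  differentiable, and so up to finitely many parameters.
\<close>

lemma has_integral_slice_integrand:
  assumes \<gamma>: "valid_path \<gamma>"
    and eq: "\<And>t. t \<in> {0..1} \<Longrightarrow> g t = \<omega> (slice_path j \<gamma> t)
      (slice_embed j (vector_derivative \<gamma> (at t within {0..1})) * - j)"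
    and g: "(g has_integral I) {0..1}"
  shows "(slice_integrand j \<omega> \<gamma> has_integral I) {0..1}"
proof -
  obtain T where T: "finite T" "\<gamma> C1_differentiable_on {0..1} - T"
    using \<gamma> by (auto simp: valid_path_def piecewise_C1_differentiable_on_def)
  show ?thesis
  proof (rule has_integral_spike_finite[OF T(1) _ g])
    fix t assume t: "t \<in> {0..1} - T"
    then have "\<gamma> differentiable at t" using T(2) by (auto simp: C1_differentiable_on_eq)
    then have d: "(\<gamma> has_vector_derivative vector_derivative \<gamma> (at t)) (at t within {0..1})"
      using vector_derivative_works has_vector_derivative_at_within by blast
    have v: "vector_derivative \<gamma> (at t within {0..1}) = vector_derivative \<gamma> (at t)"
      using t d by (intro vector_derivative_within_closed_interval) auto
    have path: "slice_path j \<gamma> = (\<lambda>t. slice_embed j (\<gamma> t))"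
      by (simp add: fun_eq_iff slice_path_def slice_embed_def)
    have "bounded_linear (slice_embed j)" using linear_slice_embed linear_conv_bounded_linear by blast
    from bounded_linear.has_vector_derivative[OF this d]
    have "vector_derivative (slice_path j \<gamma>) (at t within {0..1})
        = slice_embed j (vector_derivative \<gamma> (at t within {0..1}))"
      unfolding path v using t by (intro vector_derivative_within_closed_interval) auto
    then show "slice_integrand j \<omega> \<gamma> t = g t" using t eq[of t] by (simp add: slice_integrand_def)
  qed
qed

lemma bounded_linear_clifford_mult:
  fixes a :: "'n::{finite,linorder} clifford"
  shows "bounded_linear (\<lambda>y. a * y)" "bounded_linear (\<lambda>y. y * a)"
  unfolding linear_conv_bounded_linear[symmetric]
  by (rule linearI; simp add: algebra_simps)+

text \<open>
  The value \<open>f x\<close> and the kernel at \<open>x = u + i v\<close> are the same combination, with the coefficients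
  \<open>(1 - i j) / 2\<close> and \<open>(1 + i j) / 2\<close>, of values and kernels at the points \<open>z\<close> and \<open>cnj z\<close> of the slice of \<open>j\<close>.
  So the formula is this combination of Cauchy's formulas at these two points.
\<close>

theorem left_slice_Cauchy_formula:
  fixes f :: "'n::{finite,linorder} clifford \<Rightarrow> 'n clifford"
  assumes U: "axially_symmetric_open U" "bounded U"
    and V: "axially_symmetric_open V" "closure U \<subseteq> V"
    and j: "j \<in> imag_sphere" and \<Gamma>: "oriented_boundary (slice_section j U) \<Gamma>"
    and f: "left_slice_monogenic V f" and x: "x \<in> U"
  shows "\<exists>I. (\<forall>\<gamma>\<in>\<Gamma>. (slice_integrand j (\<lambda>s ds. S_L s x * ds * f s) \<gamma> has_integral I \<gamma>) {0..1}) \<and>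
    sum I \<Gamma> = (2 * pi) *\<^sub>R f x"
proof -
  note jj = imag_sphere_square[OF j]
  have axU: "axially_symmetric U" using U by (simp add: axially_symmetric_open_def)
  obtain i z where i: "i \<in> imag_sphere" and xz: "x = slice_embed i z"
    and zU: "z \<in> slice_section j U" "cnj z \<in> slice_section j U"
    by (rule axially_symmetric_point[OF axU j x])
  obtain F0 F1 where eo: "even_odd_pair (stem_domain V) F0 F1"
    and C: "class_C 1 (stem_domain V) F0" "class_C 1 (stem_domain V) F1"
    and fF: "\<And>k u v. k \<in> imag_sphere \<Longrightarrow> (u, v) \<in> stem_domain V \<Longrightarrow>
        f (slice_pt k u v) = F0 (u, v) + k * F1 (u, v)"
    and CR: "\<And>k u v. k \<in> imag_sphere \<Longrightarrow> (u, v) \<in> stem_domain V \<Longrightarrow>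
        (1 / 2 ^ 1) *\<^sub>R (CR_left k ^^ 1) (\<lambda>p. F0 p + k * F1 p) (u, v) = 0"
    using f unfolding left_poly_slice_monogenic_def by blast
  have lin: "linear (\<lambda>y. j * y)" by (rule linearI) (simp_all add: algebra_simps)
  have JJ: "j * (j * y) = - y" for y using jj by (simp add: mult.assoc[symmetric])
  have CR': "diff_u (\<lambda>p. F0 p + j * F1 p) p + j * diff_v (\<lambda>p. F0 p + j * F1 p) p = 0"
    if "p \<in> stem_domain V" for p
    using CR[OF j, of "fst p" "snd p"] that by (simp add: CR_left_def)
  note Cauchy = slice_section_Cauchy_formula[OF U V j \<Gamma> lin JJ C fF[OF j] CR']
  obtain I where I: "\<And>\<gamma>. \<gamma> \<in> \<Gamma> \<Longrightarrow> ((\<lambda>t. complex_scale ((*) j)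
      (vector_derivative \<gamma> (at t within {0..1}) * - \<i> / (\<gamma> t - z)) (f (slice_path j \<gamma> t))) has_integral I \<gamma>) {0..1}"
    and sumI: "sum I \<Gamma> = (2 * pi) *\<^sub>R f (slice_embed j z)" using Cauchy[OF _ _ zU(1)] by blast
  obtain I' where I': "\<And>\<gamma>. \<gamma> \<in> \<Gamma> \<Longrightarrow> ((\<lambda>t. complex_scale ((*) j)
      (vector_derivative \<gamma> (at t within {0..1}) * - \<i> / (\<gamma> t - cnj z)) (f (slice_path j \<gamma> t))) has_integral I' \<gamma>) {0..1}"
    and sumI': "sum I' \<Gamma> = (2 * pi) *\<^sub>R f (slice_embed j (cnj z))" using Cauchy[OF _ _ zU(2)] by blast
  have scale: "complex_scale ((*) j) w y = slice_embed j w * y" for w y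
    by (simp add: complex_scale_def slice_embed_def slice_pt_def of_real_def algebra_simps)
  define K where "K \<gamma> = (1 / 2) *\<^sub>R ((1 - i * j) * I \<gamma> + (1 + i * j) * I' \<gamma>)" for \<gamma>
  have "(slice_integrand j (\<lambda>s ds. S_L s x * ds * f s) \<gamma> has_integral K \<gamma>) {0..1}" if g: "\<gamma> \<in> \<Gamma>" for \<gamma>
  proof (rule has_integral_slice_integrand)
    show "valid_path \<gamma>" using \<Gamma> g by (auto simp: oriented_boundary_def)
    let ?e = "\<lambda>z t. slice_embed j (vector_derivative \<gamma> (at t within {0..1}) * - \<i> / (\<gamma> t - z)) * f (slice_path j \<gamma> t)"
    show "((\<lambda>t. (1 / 2) *\<^sub>R ((1 - i * j) * ?e z t + (1 + i * j) * ?e (cnj z) t)) has_integral K \<gamma>) {0..1}"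
      unfolding K_def using I[OF g] I'[OF g] unfolding scale
      by (intro has_integral_cmul has_integral_add)
        (drule has_integral_linear[OF _ bounded_linear_clifford_mult(1)], simp add: o_def)+
    fix t :: real assume "t \<in> {0..1}"
    then have "\<gamma> t \<notin> slice_section j U"
      using oriented_boundary_in_frontier[OF \<Gamma> g] open_slice_section[OF U(1) j]
      by (simp add: frontier_def interior_open)
    then have "\<gamma> t \<noteq> z" "\<gamma> t \<noteq> cnj z" using zU by auto
    note S = S_L_eq_complex_kernels[OF i j this]
    have mi: "slice_embed j (- \<i>) = - j" by (simp add: slice_embed_minus slice_embed_i)
    have e: "?e z t = slice_embed j (1 / (\<gamma> t - z)) * (slice_embed j (vector_derivative \<gamma> (at t within {0..1})) * - j) * f (slice_path j \<gamma> t)" for z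
      unfolding mi[symmetric] slice_embed_mult[OF jj, symmetric] by simp
    have sp: "slice_path j \<gamma> t = slice_embed j (\<gamma> t)" by (simp add: slice_path_def slice_embed_def)
    show "(1 / 2) *\<^sub>R ((1 - i * j) * ?e z t + (1 + i * j) * ?e (cnj z) t) =
      S_L (slice_path j \<gamma> t) x * (slice_embed j (vector_derivative \<gamma> (at t within {0..1})) * - j) * f (slice_path j \<gamma> t)"
      unfolding e unfolding sp xz S by (simp only: mult_scaleR_left distrib_right mult.assoc)
  qed
  moreover have "sum K \<Gamma> = (2 * pi) *\<^sub>R f x"
  proof -
    have sub: "slice_section j U \<subseteq> slice_section j V"
      using subset_trans[OF closure_subset V(2)] by (auto simp: mem_slice_section_iff)
    have dom: "(Re z, Im z) \<in> stem_domain V" "(Re z, - Im z) \<in> stem_domain V"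
      using zU sub mem_stem_domain_iff[of V j z] mem_stem_domain_iff[of V j "cnj z"] V j
      by (auto simp: axially_symmetric_open_def)
    have fx: "f x = F0 (Re z, Im z) + i * F1 (Re z, Im z)"
      using fF[OF i dom(1)] by (simp add: xz slice_embed_def)
    have f1: "f (slice_embed j z) = F0 (Re z, Im z) + j * F1 (Re z, Im z)"
      using fF[OF j dom(1)] by (simp add: slice_embed_def)
    \<comment> \<open>The parity of \<open>F0\<close> and \<open>F1\<close> enters here.\<close>
    have f2: "f (slice_embed j (cnj z)) = F0 (Re z, Im z) - j * F1 (Re z, Im z)"
      using fF[OF j dom(2)] eo dom(1) by (auto simp: slice_embed_def even_odd_pair_def)
    have "sum K \<Gamma> = (1 / 2) *\<^sub>R ((1 - i * j) * sum I \<Gamma> + (1 + i * j) * sum I' \<Gamma>)"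
      by (simp only: K_def[abs_def] scaleR_sum_right[symmetric] sum.distrib sum_distrib_left)
    also have "\<dots> = (2 * pi) *\<^sub>R ((1 / 2) *\<^sub>R ((1 - i * j) * f (slice_embed j z) + (1 + i * j) * f (slice_embed j (cnj z))))"
      unfolding sumI sumI' by (simp add: scaleR_add_right)
    also have "(1 - i * j) * f (slice_embed j z) + (1 + i * j) * f (slice_embed j (cnj z)) = 2 *\<^sub>R f x"
      unfolding f1 f2 fx using JJ by (simp add: algebra_simps scaleR_2)
    finally show ?thesis by simp
  qed
  ultimately show ?thesis by blast
qed

theorem right_slice_Cauchy_formula:
  fixes f :: "'n::{finite,linorder} clifford \<Rightarrow> 'n clifford"
  assumes U: "axially_symmetric_open U" "bounded U"
    and V: "axially_symmetric_open V" "closure U \<subseteq> V"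
    and j: "j \<in> imag_sphere" and \<Gamma>: "oriented_boundary (slice_section j U) \<Gamma>"
    and f: "right_slice_monogenic V f" and x: "x \<in> U"
  shows "\<exists>I. (\<forall>\<gamma>\<in>\<Gamma>. (slice_integrand j (\<lambda>s ds. f s * ds * S_R s x) \<gamma> has_integral I \<gamma>) {0..1}) \<and>
    sum I \<Gamma> = (2 * pi) *\<^sub>R f x"
proof -
  note jj = imag_sphere_square[OF j]
  have axU: "axially_symmetric U" using U by (simp add: axially_symmetric_open_def)
  obtain i z where i: "i \<in> imag_sphere" and xz: "x = slice_embed i z"
    and zU: "z \<in> slice_section j U" "cnj z \<in> slice_section j U"
    by (rule axially_symmetric_point[OF axU j x])
  obtain F0 F1 where eo: "even_odd_pair (stem_domain V) F0 F1"
    and C: "class_C 1 (stem_domain V) F0" "class_C 1 (stem_domain V) F1"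
    and fF: "\<And>k u v. k \<in> imag_sphere \<Longrightarrow> (u, v) \<in> stem_domain V \<Longrightarrow>
        f (slice_pt k u v) = F0 (u, v) + F1 (u, v) * k"
    and CR: "\<And>k u v. k \<in> imag_sphere \<Longrightarrow> (u, v) \<in> stem_domain V \<Longrightarrow>
        (1 / 2 ^ 1) *\<^sub>R (CR_right k ^^ 1) (\<lambda>p. F0 p + F1 p * k) (u, v) = 0"
    using f unfolding right_poly_slice_monogenic_def by blast
  have lin: "linear (\<lambda>y. y * j)" by (rule linearI) (simp_all add: algebra_simps)
  have JJ: "y * j * j = - y" for y using jj by (simp add: mult.assoc)
  have CR': "diff_u (\<lambda>p. F0 p + F1 p * j) p + diff_v (\<lambda>p. F0 p + F1 p * j) p * j = 0"
    if "p \<in> stem_domain V" for p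
    using CR[OF j, of "fst p" "snd p"] that by (simp add: CR_right_def)
  note Cauchy = slice_section_Cauchy_formula[OF U V j \<Gamma> lin JJ C fF[OF j] CR']
  obtain I where I: "\<And>\<gamma>. \<gamma> \<in> \<Gamma> \<Longrightarrow> ((\<lambda>t. complex_scale (\<lambda>y. y * j)
      (vector_derivative \<gamma> (at t within {0..1}) * - \<i> / (\<gamma> t - z)) (f (slice_path j \<gamma> t))) has_integral I \<gamma>) {0..1}"
    and sumI: "sum I \<Gamma> = (2 * pi) *\<^sub>R f (slice_embed j z)" using Cauchy[OF _ _ zU(1)] by blast
  obtain I' where I': "\<And>\<gamma>. \<gamma> \<in> \<Gamma> \<Longrightarrow> ((\<lambda>t. complex_scale (\<lambda>y. y * j)
      (vector_derivative \<gamma> (at t within {0..1}) * - \<i> / (\<gamma> t - cnj z)) (f (slice_path j \<gamma> t))) has_integral I' \<gamma>) {0..1}"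
    and sumI': "sum I' \<Gamma> = (2 * pi) *\<^sub>R f (slice_embed j (cnj z))" using Cauchy[OF _ _ zU(2)] by blast
  have scale: "complex_scale (\<lambda>y. y * j) w y = y * slice_embed j w" for w y
    by (simp add: complex_scale_def slice_embed_def slice_pt_def of_real_def algebra_simps)
  define K where "K \<gamma> = (1 / 2) *\<^sub>R (I \<gamma> * (1 - j * i) + I' \<gamma> * (1 + j * i))" for \<gamma>
  have "(slice_integrand j (\<lambda>s ds. f s * ds * S_R s x) \<gamma> has_integral K \<gamma>) {0..1}" if g: "\<gamma> \<in> \<Gamma>" for \<gamma>
  proof (rule has_integral_slice_integrand)
    show "valid_path \<gamma>" using \<Gamma> g by (auto simp: oriented_boundary_def)
    let ?e = "\<lambda>z t. f (slice_path j \<gamma> t) * slice_embed j (vector_derivative \<gamma> (at t within {0..1}) * - \<i> / (\<gamma> t - z))"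
    show "((\<lambda>t. (1 / 2) *\<^sub>R (?e z t * (1 - j * i) + ?e (cnj z) t * (1 + j * i))) has_integral K \<gamma>) {0..1}"
      unfolding K_def using I[OF g] I'[OF g] unfolding scale
      by (intro has_integral_cmul has_integral_add)
        (drule has_integral_linear[OF _ bounded_linear_clifford_mult(2)], simp add: o_def)+
    fix t :: real assume "t \<in> {0..1}"
    then have "\<gamma> t \<notin> slice_section j U"
      using oriented_boundary_in_frontier[OF \<Gamma> g] open_slice_section[OF U(1) j]
      by (simp add: frontier_def interior_open)
    then have "\<gamma> t \<noteq> z" "\<gamma> t \<noteq> cnj z" using zU by auto
    note S = S_R_eq_complex_kernels[OF i j this]
    have mi: "slice_embed j (- \<i>) = - j" by (simp add: slice_embed_minus slice_embed_i)
    have e: "?e z t = f (slice_path j \<gamma> t) * (slice_embed j (vector_derivative \<gamma> (at t within {0..1})) * - j) * slice_embed j (1 / (\<gamma> t - z))" for z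
      unfolding mi[symmetric] mult.assoc slice_embed_mult[OF jj, symmetric] by simp
    have sp: "slice_path j \<gamma> t = slice_embed j (\<gamma> t)" by (simp add: slice_path_def slice_embed_def)
    show "(1 / 2) *\<^sub>R (?e z t * (1 - j * i) + ?e (cnj z) t * (1 + j * i)) =
      f (slice_path j \<gamma> t) * (slice_embed j (vector_derivative \<gamma> (at t within {0..1})) * - j) * S_R (slice_path j \<gamma> t) x"
      unfolding e unfolding sp xz S by (simp only: mult_scaleR_right distrib_left mult.assoc)
  qed
  moreover have "sum K \<Gamma> = (2 * pi) *\<^sub>R f x"
  proof -
    have sub: "slice_section j U \<subseteq> slice_section j V"
      using subset_trans[OF closure_subset V(2)] by (auto simp: mem_slice_section_iff)
    have dom: "(Re z, Im z) \<in> stem_domain V" "(Re z, - Im z) \<in> stem_domain V"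
      using zU sub mem_stem_domain_iff[of V j z] mem_stem_domain_iff[of V j "cnj z"] V j
      by (auto simp: axially_symmetric_open_def)
    have fx: "f x = F0 (Re z, Im z) + F1 (Re z, Im z) * i"
      using fF[OF i dom(1)] by (simp add: xz slice_embed_def)
    have f1: "f (slice_embed j z) = F0 (Re z, Im z) + F1 (Re z, Im z) * j"
      using fF[OF j dom(1)] by (simp add: slice_embed_def)
    \<comment> \<open>The parity of \<open>F0\<close> and \<open>F1\<close> enters here.\<close>
    have f2: "f (slice_embed j (cnj z)) = F0 (Re z, Im z) - F1 (Re z, Im z) * j"
      using fF[OF j dom(2)] eo dom(1) by (auto simp: slice_embed_def even_odd_pair_def)
    have "sum K \<Gamma> = (1 / 2) *\<^sub>R (sum I \<Gamma> * (1 - j * i) + sum I' \<Gamma> * (1 + j * i))"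
      by (simp only: K_def[abs_def] scaleR_sum_right[symmetric] sum.distrib sum_distrib_right)
    also have "\<dots> = (2 * pi) *\<^sub>R ((1 / 2) *\<^sub>R (f (slice_embed j z) * (1 - j * i) + f (slice_embed j (cnj z)) * (1 + j * i)))"
      unfolding sumI sumI' by (simp add: scaleR_add_right)
    also have "f (slice_embed j z) * (1 - j * i) + f (slice_embed j (cnj z)) * (1 + j * i) = 2 *\<^sub>R f x"
      unfolding f1 f2 fx using JJ by (simp add: algebra_simps scaleR_2 flip: mult.assoc)
    finally show ?thesis by simp
  qed
  ultimately show ?thesis by blast
qed


text \<open>
  The power of \<open>pconj x\<close> does not depend on the variable of integration and multiplies the whole
  Cauchy formula for \<open>f k\<close> from the outside.
\<close>

theorem left_poly_slice_Cauchy_formula: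
  fixes f :: "nat \<Rightarrow> 'n::{finite,linorder} clifford \<Rightarrow> 'n clifford"
  assumes U: "axially_symmetric_open U" "bounded U"
    and V: "axially_symmetric_open V" "closure U \<subseteq> V"
    and j: "j \<in> imag_sphere" and \<Gamma>: "oriented_boundary (slice_section j U) \<Gamma>"
    and f: "left_components M V F f" and x: "x \<in> U"
  defines "\<omega> \<equiv> \<lambda>s ds. \<Sum>k<M. pconj x ^ k * S_L s x * ds * f k s"
  shows "slice_integrable j \<Gamma> \<omega> \<and> slice_integral j \<Gamma> \<omega> = (2 * pi) *\<^sub>R F x"
proof -
  let ?g = "\<lambda>k. slice_integrand j (\<lambda>s ds. S_L s x * ds * f k s)"
  have ex: "\<exists>I. (\<forall>\<gamma>\<in>\<Gamma>. (?g k \<gamma> has_integral I \<gamma>) {0..1}) \<and> sum I \<Gamma> = (2 * pi) *\<^sub>R f k x"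
    if "k < M" for k
    using left_slice_Cauchy_formula[OF U V j \<Gamma> _ x, of "f k"] f that by (auto simp: left_components_def)
  define I where "I k = (SOME I. (\<forall>\<gamma>\<in>\<Gamma>. (?g k \<gamma> has_integral I \<gamma>) {0..1}) \<and>
      sum I \<Gamma> = (2 * pi) *\<^sub>R f k x)" for k
  have I: "(?g k \<gamma> has_integral I k \<gamma>) {0..1}" if "k < M" "\<gamma> \<in> \<Gamma>" for k \<gamma>
    using someI_ex[OF ex[OF that(1)]] that(2) unfolding I_def by blast
  have sumI: "sum (I k) \<Gamma> = (2 * pi) *\<^sub>R f k x" if "k < M" for k
    using someI_ex[OF ex[OF that]] unfolding I_def by blast
  have int: "(slice_integrand j \<omega> \<gamma> has_integral (\<Sum>k<M. pconj x ^ k * I k \<gamma>)) {0..1}" if g: "\<gamma> \<in> \<Gamma>" for \<gamma>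
  proof -
    have "slice_integrand j \<omega> \<gamma> = (\<lambda>t. \<Sum>k<M. pconj x ^ k * ?g k \<gamma> t)"
      by (simp add: fun_eq_iff slice_integrand_def \<omega>_def mult.assoc)
    moreover have "((\<lambda>t. pconj x ^ k * ?g k \<gamma> t) has_integral pconj x ^ k * I k \<gamma>) {0..1}" if "k < M" for k
      using has_integral_linear[OF I[OF that g] bounded_linear_clifford_mult(1)] by (simp add: o_def)
    ultimately show ?thesis by (auto intro!: has_integral_sum)
  qed
  have "slice_integral j \<Gamma> \<omega> = (\<Sum>\<gamma>\<in>\<Gamma>. \<Sum>k<M. pconj x ^ k * I k \<gamma>)"
    unfolding slice_integral_def using int by (intro sum.cong refl integral_unique)
  also have "\<dots> = (\<Sum>k<M. pconj x ^ k * sum (I k) \<Gamma>)"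
    by (subst sum.swap) (simp add: sum_distrib_left)
  also have "\<dots> = (2 * pi) *\<^sub>R (\<Sum>k<M. pconj x ^ k * f k x)"
    by (simp add: sumI scaleR_sum_right)
  also have "(\<Sum>k<M. pconj x ^ k * f k x) = F x"
    using f x subset_trans[OF closure_subset V(2)] by (auto simp: left_components_def)
  finally show ?thesis using int by (auto simp: slice_integrable_def integrable_on_def)
qed

theorem right_poly_slice_Cauchy_formula:
  fixes f :: "nat \<Rightarrow> 'n::{finite,linorder} clifford \<Rightarrow> 'n clifford"
  assumes U: "axially_symmetric_open U" "bounded U"
    and V: "axially_symmetric_open V" "closure U \<subseteq> V"
    and j: "j \<in> imag_sphere" and \<Gamma>: "oriented_boundary (slice_section j U) \<Gamma>"
    and f: "right_components M V F f" and x: "x \<in> U"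
  defines "\<omega> \<equiv> \<lambda>s ds. \<Sum>k<M. f k s * ds * S_R s x * pconj x ^ k"
  shows "slice_integrable j \<Gamma> \<omega> \<and> slice_integral j \<Gamma> \<omega> = (2 * pi) *\<^sub>R F x"
proof -
  let ?g = "\<lambda>k. slice_integrand j (\<lambda>s ds. f k s * ds * S_R s x)"
  have ex: "\<exists>I. (\<forall>\<gamma>\<in>\<Gamma>. (?g k \<gamma> has_integral I \<gamma>) {0..1}) \<and> sum I \<Gamma> = (2 * pi) *\<^sub>R f k x"
    if "k < M" for k
    using right_slice_Cauchy_formula[OF U V j \<Gamma> _ x, of "f k"] f that by (auto simp: right_components_def)
  define I where "I k = (SOME I. (\<forall>\<gamma>\<in>\<Gamma>. (?g k \<gamma> has_integral I \<gamma>) {0..1}) \<and>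
      sum I \<Gamma> = (2 * pi) *\<^sub>R f k x)" for k
  have I: "(?g k \<gamma> has_integral I k \<gamma>) {0..1}" if "k < M" "\<gamma> \<in> \<Gamma>" for k \<gamma>
    using someI_ex[OF ex[OF that(1)]] that(2) unfolding I_def by blast
  have sumI: "sum (I k) \<Gamma> = (2 * pi) *\<^sub>R f k x" if "k < M" for k
    using someI_ex[OF ex[OF that]] unfolding I_def by blast
  have int: "(slice_integrand j \<omega> \<gamma> has_integral (\<Sum>k<M. I k \<gamma> * pconj x ^ k)) {0..1}" if g: "\<gamma> \<in> \<Gamma>" for \<gamma>
  proof -
    have "slice_integrand j \<omega> \<gamma> = (\<lambda>t. \<Sum>k<M. ?g k \<gamma> t * pconj x ^ k)"
      by (simp add: fun_eq_iff slice_integrand_def \<omega>_def mult.assoc)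
    moreover have "((\<lambda>t. ?g k \<gamma> t * pconj x ^ k) has_integral I k \<gamma> * pconj x ^ k) {0..1}" if "k < M" for k
      using has_integral_linear[OF I[OF that g] bounded_linear_clifford_mult(2)] by (simp add: o_def)
    ultimately show ?thesis by (auto intro!: has_integral_sum)
  qed
  have "slice_integral j \<Gamma> \<omega> = (\<Sum>\<gamma>\<in>\<Gamma>. \<Sum>k<M. I k \<gamma> * pconj x ^ k)"
    unfolding slice_integral_def using int by (intro sum.cong refl integral_unique)
  also have "\<dots> = (\<Sum>k<M. sum (I k) \<Gamma> * pconj x ^ k)"
    by (subst sum.swap) (simp add: sum_distrib_right)
  also have "\<dots> = (2 * pi) *\<^sub>R (\<Sum>k<M. f k x * pconj x ^ k)"
    by (simp add: sumI scaleR_sum_right)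
  also have "(\<Sum>k<M. f k x * pconj x ^ k) = F x"
    using f x subset_trans[OF closure_subset V(2)] by (auto simp: right_components_def)
  finally show ?thesis using int by (auto simp: slice_integrable_def integrable_on_def)
qed

theorem corollary3p12:
  fixes M :: nat
    and U V :: "'n::{finite,linorder} clifford set"
    and j :: "'n clifford"
    and \<Gamma> :: "(real \<Rightarrow> complex) set"
    and F :: "'n clifford \<Rightarrow> 'n clifford"
    and f :: "nat \<Rightarrow> 'n clifford \<Rightarrow> 'n clifford"
  assumes M: "1 \<le> M"
    and U: "slice_cauchy_domain U" "bounded U"
    and j: "j \<in> imag_sphere"
    and \<Gamma>: "oriented_boundary (slice_section j U) \<Gamma>"
    and V: "axially_symmetric_open V" "closure U \<subseteq> V"
  shows
    "(left_poly_slice_monogenic M V F \<and> left_components M V F f \<longrightarrow>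
       (\<forall>x\<in>U.
          slice_integrable j \<Gamma> (\<lambda>s ds. \<Sum>k<M. pconj x ^ k * S_L s x * ds * f k s) \<and>
          F x = (1 / (2 * pi)) *\<^sub>R
            slice_integral j \<Gamma> (\<lambda>s ds. \<Sum>k<M. pconj x ^ k * S_L s x * ds * f k s)) \<and>
       (\<forall>U' j' \<Gamma>'. slice_cauchy_domain U' \<and> bounded U' \<and> closure U' \<subseteq> V \<and>
          j' \<in> imag_sphere \<and> oriented_boundary (slice_section j' U') \<Gamma>' \<longrightarrow>
          (\<forall>x\<in>U \<inter> U'.
             slice_integral j \<Gamma> (\<lambda>s ds. \<Sum>k<M. pconj x ^ k * S_L s x * ds * f k s) =
             slice_integral j' \<Gamma>' (\<lambda>s ds. \<Sum>k<M. pconj x ^ k * S_L s x * ds * f k s))))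
     \<and>
     (right_poly_slice_monogenic M V F \<and> right_components M V F f \<longrightarrow>
       (\<forall>x\<in>U.
          slice_integrable j \<Gamma> (\<lambda>s ds. \<Sum>k<M. f k s * ds * S_R s x * pconj x ^ k) \<and>
          F x = (1 / (2 * pi)) *\<^sub>R
            slice_integral j \<Gamma> (\<lambda>s ds. \<Sum>k<M. f k s * ds * S_R s x * pconj x ^ k)) \<and>
       (\<forall>U' j' \<Gamma>'. slice_cauchy_domain U' \<and> bounded U' \<and> closure U' \<subseteq> V \<and>
          j' \<in> imag_sphere \<and> oriented_boundary (slice_section j' U') \<Gamma>' \<longrightarrow>
          (\<forall>x\<in>U \<inter> U'.
             slice_integral j \<Gamma> (\<lambda>s ds. \<Sum>k<M. f k s * ds * S_R s x * pconj x ^ k) =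
             slice_integral j' \<Gamma>' (\<lambda>s ds. \<Sum>k<M. f k s * ds * S_R s x * pconj x ^ k))))"
proof (intro conjI impI ballI allI)
  have axU: "axially_symmetric_open U" using U by (simp add: slice_cauchy_domain_def)
  note left = left_poly_slice_Cauchy_formula and right = right_poly_slice_Cauchy_formula
  {
    assume "left_poly_slice_monogenic M V F \<and> left_components M V F f"
    then have f: "left_components M V F f" by blast
    note * = left[OF axU U(2) V j \<Gamma> f]
    fix x
    {
      assume x: "x \<in> U"
      show "slice_integrable j \<Gamma> (\<lambda>s ds. \<Sum>k<M. pconj x ^ k * S_L s x * ds * f k s)"
        using *[OF x] by blast
      show "F x = (1 / (2 * pi)) *\<^sub>R
          slice_integral j \<Gamma> (\<lambda>s ds. \<Sum>k<M. pconj x ^ k * S_L s x * ds * f k s)"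
        using *[OF x] by simp
    }
    fix U' :: "'n clifford set" and j' :: "'n clifford" and \<Gamma>'
    assume 1: "slice_cauchy_domain U' \<and> bounded U' \<and> closure U' \<subseteq> V \<and>
        j' \<in> imag_sphere \<and> oriented_boundary (slice_section j' U') \<Gamma>'" and x: "x \<in> U \<inter> U'"
    then show "slice_integral j \<Gamma> (\<lambda>s ds. \<Sum>k<M. pconj x ^ k * S_L s x * ds * f k s) =
        slice_integral j' \<Gamma>' (\<lambda>s ds. \<Sum>k<M. pconj x ^ k * S_L s x * ds * f k s)"
      using *[of x] left[OF _ _ V(1) _ _ _ f, of U' j' \<Gamma>' x] by (simp add: slice_cauchy_domain_def)
  }
  {
    assume "right_poly_slice_monogenic M V F \<and> right_components M V F f"
    then have f: "right_components M V F f" by blast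
    note * = right[OF axU U(2) V j \<Gamma> f]
    fix x
    {
      assume x: "x \<in> U"
      show "slice_integrable j \<Gamma> (\<lambda>s ds. \<Sum>k<M. f k s * ds * S_R s x * pconj x ^ k)"
        using *[OF x] by blast
      show "F x = (1 / (2 * pi)) *\<^sub>R
          slice_integral j \<Gamma> (\<lambda>s ds. \<Sum>k<M. f k s * ds * S_R s x * pconj x ^ k)"
        using *[OF x] by simp
    }
    fix U' :: "'n clifford set" and j' :: "'n clifford" and \<Gamma>'
    assume 1: "slice_cauchy_domain U' \<and> bounded U' \<and> closure U' \<subseteq> V \<and>
        j' \<in> imag_sphere \<and> oriented_boundary (slice_section j' U') \<Gamma>'" and x: "x \<in> U \<inter> U'"
    then show "slice_integral j \<Gamma> (\<lambda>s ds. \<Sum>k<M. f k s * ds * S_R s x * pconj x ^ k) =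
        slice_integral j' \<Gamma>' (\<lambda>s ds. \<Sum>k<M. f k s * ds * S_R s x * pconj x ^ k)"
      using *[of x] right[OF _ _ V(1) _ _ _ f, of U' j' \<Gamma>' x] by (simp add: slice_cauchy_domain_def)
  }
qed

end
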